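(* Let $a<b$ be real, $\mathcal{Q}=[a,b]$, and let $\nu$ be the Lebesgue measure on $[a,b]$. Let $$H(s,q)=\sum_{i=1}^{n}\frac{\Phi_i}{s-\nu_i(q)},\qquad\hat H(s,q)=\sum_{i=1}^{r}\frac{c_ib_i^*}{s-\lambda_i(q)},$$ where $\nu_i(q)=\nu_{1,i}+q\,\nu_{2,i}$ and $\lambda_i(q)=\lambda_{1,i}+q\,\lambda_{2,i}$ with $\nu_{k,i},\lambda_{k,i}\in\mathbb{C}$, be the transfer functions, respectively, of a full-order model with $\mathcal{E}(q)=I$, $\mathcal{A}(q)=A_1+qA_2$, $\mathcal{B}(q)=B$, $\mathcal{C}(q)=C$, and a reduced-order model with $\hat{\mathcal{E}}(q)=I$, $\hat{\mathcal{A}}(q)=\hat A_1+q\hat A_2$, $\hat{\mathcal{B}}(q)=\hat B$, $\hat{\mathcal{C}}(q)=\hat C$, where $A_k=\operatorname{diag}(\nu_{k,1},\dots,\nu_{k,n})$ and $\hat A_k=\operatorname{diag}(\lambda_{k,1},\dots,\lambda_{k,r})$ for $k=1,2$; thus $\Phi_i=(Ce_i)(e_i^{\rm T}B)\in\mathbb{C}^{n_{\rm o}\times n_{\rm i}}$, $c_i=\hat Ce_i\in\mathbb{C}^{n_{\rm o}}$ and $b_i=\hat B^*e_i\in\mathbb{C}^{n_{\rm i}}$. Assume that $\nu_i(q)$ and $\lambda_i(q)$ lie in the open left half-plane $\mathbb{C}_-$ for all $q\in[a,b]$ and all $i$. For $\sigma_a,\sigma_b\in\mathbb{C}_-$ define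 $f_{\sigma_a,\sigma_b}:\mathbb{C}_+^2\to\mathbb{C}$ by $$f_{\sigma_a,\sigma_b}(s_a,s_b)=\frac{b-a}{(s_b-\sigma_b)-(s_a-\sigma_a)}\ln\left(\frac{s_b-\sigma_b}{s_a-\sigma_a}\right),$$ and define $G,\hat G:\mathbb{C}_+^2\to\mathbb{C}^{n_{\rm o}\times n_{\rm i}}$ by $$G(s_a,s_b)=\sum_{i=1}^{n}f_{\nu_i(a),\nu_i(b)}(s_a,s_b)\,\Phi_i,\qquad\hat G(s_a,s_b)=\sum_{i=1}^{r}f_{\lambda_i(a),\lambda_i(b)}(s_a,s_b)\,c_ib_i^*.$$ If $\hat H$ is an $\mathcal{H}_2\otimes\mathcal{L}_2$-optimal diagonal structured reduced-order model (D-StROM) for $H$, then for $i=1,2,\dots,r$, $$G\bigl(-\overline{\lambda_i(a)},-\overline{\lambda_i(b)}\bigr)b_i=\hat G\bigl(-\overline{\lambda_i(a)},-\overline{\lambda_i(b)}\bigr)b_i,$$ $$c_i^*G\bigl(-\overline{\lambda_i(a)},-\overline{\lambda_i(b)}\bigr)=c_i^*\hat G\bigl(-\overline{\lambda_i(a)},-\overline{\lambda_i(b)}\bigr),$$ $$c_i^*\frac{\partial G}{\partial s_a}\bigl(-\overline{\lambda_i(a)},-\overline{\lambda_i(b)}\bigr)b_i=c_i^*\frac{\partial\hat G}{\partial s_a}\bigl(-\overline{\lambda_i(a)},-\overline{\lambda_i(b)}\bigr)b_i,$$ $$c_i^*\frac{\partial G}{\partial s_b}\bigl(-\overline{\lambda_i(a)},-\overline{\lambda_i(b)}\bigr)b_i=c_i^*\frac{\partial\hat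 G}{\partial s_b}\bigl(-\overline{\lambda_i(a)},-\overline{\lambda_i(b)}\bigr)b_i.$$
   Context: Notation: $\mathbb{C}_-$ and $\mathbb{C}_+$ are the open left and right half-planes; $e_i$ is the $i$th standard basis vector; $^*$ is the conjugate transpose; $\overline{\,\cdot\,}$ is complex conjugation. $\ln$ is the principal branch of the logarithm, and $f_{\sigma_a,\sigma_b}$ is understood as extended by continuity across the removable singularity $s_b-\sigma_b=s_a-\sigma_a$ (with value $(b-a)/(s_a-\sigma_a)$ there). $\mathcal{H}_2$ is the Hardy space of matrix-valued functions analytic in the open right half-plane, with norm $\|F\|_{\mathcal{H}_2}=\bigl(\frac{1}{2\pi}\int_{-\infty}^{\infty}\|F(\boldsymbol{i}\omega)\|_{\rm F}^2\,d\omega\bigr)^{1/2}$, and $$\|H\|_{\mathcal{H}_2\otimes\mathcal{L}_2}=\Bigl(\int_a^b\|H(\cdot,q)\|_{\mathcal{H}_2}^2\,dq\Bigr)^{1/2}.$$ $\hat H$ is an $\mathcal{H}_2\otimes\mathcal{L}_2$-optimal D-StROM for $H$ if $(\hat A_1,\hat A_2,\hat B,\hat C)$ is a (local) minimizer of $\|H-\hat H\|_{\mathcal{H}_2\otimes\mathcal{L}_2}$ over all reduced-order models of the same form and order $r$, i.e. over diagonal $\hat A_1,\hat A_2\in\mathbb{C}^{r\times r}$, $\hat B\in\mathbb{C}^{r\times n_{\rm i}}$, $\hat C\in\mathbb{C}^{n_{\rm o}\times r}$. *)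

theory Defs
  imports "HOL-Complex_Analysis.Complex_Analysis"
begin

text \<open>A p x m complex matrix has type \<^typ>\<open>complex^'m^'p\<close>; its library norm (the Euclidean norm of
  the vector of Euclidean row norms) is the Frobenius norm.\<close>

definition conj_vec :: "complex^'n \<Rightarrow> complex^'n" where
  "conj_vec v = (\<chi> i. cnj (v $ i))"

definition conj_transpose :: "complex^'m^'p \<Rightarrow> complex^'p^'m" where
  "conj_transpose A = (\<chi> i j. cnj (A $ j $ i))"

text \<open>The outer product is bilinear (no conjugation); thus \<open>c b\<^sup>*\<close> is \<open>outer c (conj_vec b)\<close>.\<close>

definition outer :: "complex^'p \<Rightarrow> complex^'m \<Rightarrow> complex^'m^'p" where
  "outer u v = (\<chi> i j. u $ i * v $ j)"

definition conj_dot :: "complex^'p \<Rightarrow> complex^'p \<Rightarrow> complex" where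
  "conj_dot c v = (\<Sum>k\<in>UNIV. cnj (c $ k) * v $ k)"

definition cscale :: "complex \<Rightarrow> complex^'m^'p \<Rightarrow> complex^'m^'p" where
  "cscale z M = map_matrix (\<lambda>x. z * x) M"

definition diag_of :: "complex^'n \<Rightarrow> complex^'n^'n" where
  "diag_of v = (\<chi> i j. if i = j then v $ i else 0)"

definition is_diagonal :: "complex^'n^'n \<Rightarrow> bool" where
  "is_diagonal A \<longleftrightarrow> (\<forall>i j. i \<noteq> j \<longrightarrow> A $ i $ j = 0)"

definition matrix_deriv :: "(complex \<Rightarrow> complex^'m^'p) \<Rightarrow> complex \<Rightarrow> complex^'m^'p" where
  "matrix_deriv F z = (\<chi> k l. deriv (\<lambda>s. F s $ k $ l) z)"

subsection \<open>Parametric transfer functions\<close>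

definition transfer_function ::
    "(real \<Rightarrow> complex^'n^'n) \<Rightarrow> (real \<Rightarrow> complex^'n^'n) \<Rightarrow> (real \<Rightarrow> complex^'m^'n) \<Rightarrow>
     (real \<Rightarrow> complex^'n^'p) \<Rightarrow> complex \<Rightarrow> real \<Rightarrow> complex^'m^'p" where
  "transfer_function \<E> \<A> \<B> \<C> s q = \<C> q ** matrix_inv (cscale s (\<E> q) - \<A> q) ** \<B> q"

definition affine_tf ::
    "complex^'n^'n \<Rightarrow> complex^'n^'n \<Rightarrow> complex^'m^'n \<Rightarrow> complex^'n^'p \<Rightarrow>
     complex \<Rightarrow> real \<Rightarrow> complex^'m^'p" where
  "affine_tf A1 A2 B C =
     transfer_function (\<lambda>_. mat 1) (\<lambda>q. A1 + q *\<^sub>R A2) (\<lambda>_. B) (\<lambda>_. C)"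

text \<open>The pole-residue form of the transfer function in the diagonal case.\<close>

lemma affine_tf_diag:
  fixes p1 p2 :: "complex^'n" and B :: "complex^'m^'n" and C :: "complex^'n^'p"
  assumes "\<And>i. s \<noteq> p1 $ i + of_real q * p2 $ i"
  shows "affine_tf (diag_of p1) (diag_of p2) B C s q =
    (\<Sum>i\<in>UNIV. cscale (1 / (s - (p1 $ i + of_real q * p2 $ i)))
                  (outer (column i C) (row i B)))"
proof -
  define d where "d = (\<chi> i. s - (p1 $ i + of_real q * p2 $ i))"
  define e where "e = (\<chi> i. 1 / (s - (p1 $ i + of_real q * p2 $ i)))"
  have de: "d $ i * e $ i = 1" "e $ i * d $ i = 1" for i
    using assms[of i] by (auto simp: d_def e_def)
  have e: "e $ i = 1 / (s - (p1 $ i + of_real q * p2 $ i))" for i by (simp add: e_def)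
  have M: "cscale s (mat 1) - (diag_of p1 + q *\<^sub>R diag_of p2) = diag_of d"
    by (auto simp: vec_eq_iff cscale_def mat_def diag_of_def d_def scaleR_conv_of_real[where 'a=complex])
  have mult: "diag_of u ** diag_of v = diag_of (\<chi> i. u $ i * v $ i)" for u v :: "complex^'n"
  proof -
    have "(\<Sum>k\<in>UNIV. (if i = k then u $ i else 0) * (if k = j then v $ k else 0))
        = (if i = j then u $ i * v $ i else 0)" for i j
    proof -
      have "(\<Sum>k\<in>UNIV. (if i = k then u $ i else 0) * (if k = j then v $ k else 0))
          = (\<Sum>k\<in>UNIV. if i = k then u $ i * (if k = j then v $ k else 0) else 0)"
        by (rule sum.cong) auto
      then show ?thesis by simp
    qed
    then show ?thesis by (simp add: vec_eq_iff matrix_matrix_mult_def diag_of_def)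
  qed
  have one: "diag_of d ** diag_of e = mat 1" "diag_of e ** diag_of d = mat 1"
    by (simp_all add: mult de) (simp_all add: diag_of_def mat_def vec_eq_iff)
  have inv: "matrix_inv (diag_of d) = diag_of e"
    unfolding matrix_inv_def
  proof (rule some_equality)
    show "diag_of d ** diag_of e = mat 1 \<and> diag_of e ** diag_of d = mat 1"
      using one by simp
  next
    fix X assume X: "diag_of d ** X = mat 1 \<and> X ** diag_of d = mat 1"
    have "X = (diag_of e ** diag_of d) ** X" by (simp add: one)
    also have "\<dots> = diag_of e" using X by (metis matrix_mul_assoc matrix_mul_rid)
    finally show "X = diag_of e" .
  qed
  have "(\<Sum>k\<in>UNIV. C $ i $ k * (if k = l then e $ k else 0)) = C $ i $ l * e $ l" for i l
  proof -
    have "(\<Sum>k\<in>UNIV. C $ i $ k * (if k = l then e $ k else 0))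
        = (\<Sum>k\<in>UNIV. if k = l then C $ i $ k * e $ k else 0)"
      by (rule sum.cong) auto
    then show ?thesis by simp
  qed
  then show ?thesis
    unfolding affine_tf_def transfer_function_def M inv
    by (auto simp: vec_eq_iff matrix_matrix_mult_def diag_of_def outer_def cscale_def
        column_def row_def e intro!: sum.cong)
qed

subsection \<open>The Hardy space and the parametric norm\<close>

definition hardy_H2 :: "(complex \<Rightarrow> complex^'m^'p) set" where
  "hardy_H2 = {F. (\<forall>k l. (\<lambda>s. F s $ k $ l) holomorphic_on {s. Re s > 0}) \<and>
     (SUP x\<in>{0<..}. \<integral>\<^sup>+\<omega>. ennreal ((norm (F (Complex x \<omega>)))\<^sup>2) \<partial>lborel) < \<infinity>}"

text \<open>An element of the Hardy space lives on the open right half-plane only; its value at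
  \<open>\<i>\<omega>\<close> is the horizontal limit, which exists for almost every \<open>\<omega>\<close>, and for all \<open>\<omega>\<close> and
  agrees with \<open>F (\<i>\<omega>)\<close> if F is continuous up to the imaginary axis.\<close>

definition boundary_value :: "(complex \<Rightarrow> complex^'m^'p) \<Rightarrow> real \<Rightarrow> complex^'m^'p" where
  "boundary_value F \<omega> = Lim (at_right 0) (\<lambda>x. F (Complex x \<omega>))"

definition H2_norm :: "(complex \<Rightarrow> complex^'m^'p) \<Rightarrow> real" where
  "H2_norm F = sqrt (1 / (2 * pi) * (\<integral>\<omega>. (norm (boundary_value F \<omega>))\<^sup>2 \<partial>lborel))"

definition H2_L2 :: "real \<Rightarrow> real \<Rightarrow> (complex \<Rightarrow> real \<Rightarrow> complex^'m^'p) set" where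
  "H2_L2 a b = {H. (AE q in lebesgue_on {a..b}. (\<lambda>s. H s q) \<in> hardy_H2) \<and>
     integrable (lebesgue_on {a..b}) (\<lambda>q. (H2_norm (\<lambda>s. H s q))\<^sup>2)}"

text \<open>The norm is extended by \<open>\<infinity>\<close> outside the space, so that reduced models whose error has
  no finite norm (for instance unstable ones) are never better than those whose error has one.\<close>

definition H2_L2_norm :: "real \<Rightarrow> real \<Rightarrow> (complex \<Rightarrow> real \<Rightarrow> complex^'m^'p) \<Rightarrow> ennreal" where
  "H2_L2_norm a b H = (if H \<in> H2_L2 a b
     then ennreal (sqrt (\<integral>q. (H2_norm (\<lambda>s. H s q))\<^sup>2 \<partial>lebesgue_on {a..b})) else \<infinity>)"

definition H2_L2_error ::
    "real \<Rightarrow> real \<Rightarrow> (complex \<Rightarrow> real \<Rightarrow> complex^'m^'p) \<Rightarrow>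
     complex^'r^'r \<Rightarrow> complex^'r^'r \<Rightarrow> complex^'m^'r \<Rightarrow> complex^'r^'p \<Rightarrow> ennreal" where
  "H2_L2_error a b H A1 A2 B C = H2_L2_norm a b (\<lambda>s q. H s q - affine_tf A1 A2 B C s q)"

text \<open>Optimality is local; every global minimizer is in particular optimal in this sense.\<close>

definition optimal_D_StROM ::
    "real \<Rightarrow> real \<Rightarrow> (complex \<Rightarrow> real \<Rightarrow> complex^'m^'p) \<Rightarrow>
     complex^'r^'r \<Rightarrow> complex^'r^'r \<Rightarrow> complex^'m^'r \<Rightarrow> complex^'r^'p \<Rightarrow> bool" where
  "optimal_D_StROM a b H A1 A2 B C \<longleftrightarrow> is_diagonal A1 \<and> is_diagonal A2 \<and>
     (\<exists>\<epsilon>>0. \<forall>A1' A2' B' C'. is_diagonal A1' \<and> is_diagonal A2' \<and>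
        dist (A1', A2', B', C') (A1, A2, B, C) < \<epsilon> \<longrightarrow>
        H2_L2_error a b H A1 A2 B C \<le> H2_L2_error a b H A1' A2' B' C')"

subsection \<open>The kernel\<close>

text \<open>The first case is the value at the removable singularity; \<^const>\<open>Ln\<close> is the principal
  branch.\<close>

definition f_kernel ::
    "real \<Rightarrow> real \<Rightarrow> complex \<Rightarrow> complex \<Rightarrow> complex \<Rightarrow> complex \<Rightarrow> complex" where
  "f_kernel a b \<sigma>a \<sigma>b sa sb =
     (if sb - \<sigma>b = sa - \<sigma>a then of_real (b - a) / (sa - \<sigma>a)
      else of_real (b - a) / ((sb - \<sigma>b) - (sa - \<sigma>a)) * Ln ((sb - \<sigma>b) / (sa - \<sigma>a)))"

end

theory Submission
  imports Defs "HOL-Probability.Sinc_Integral"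
begin

text \<open>The interpolation conditions are the first-order conditions for a minimum of the squared error,
  which in pole-residue form is a finite explicit expression.

  For fixed \<open>q\<close> the error of the reduced model is a sum of simple fractions \<open>M / (s - \<mu>)\<close>, whose
  poles \<open>\<mu>\<close> are those of both models and depend on \<open>q\<close> in an affine way. On the imaginary axis two
  simple fractions \<open>1 / (s - \<mu>)\<close> and \<open>1 / (s - \<mu>')\<close> have the inner product
  \<open>1 / (- (\<mu> + cnj \<mu>'))\<close> (\<open>integral_simple_fraction_product\<close>). Its denominator is affine in \<open>q\<close>,
  so integration over \<open>[a, b]\<close> produces the integral of a reciprocal affine function, which is the
  logarithmic kernel (\<open>f_kernel_eq_line_kernel\<close>). Hence the squared error is a Hermitian sum of
  products of Frobenius inner products of residues and kernel values (\<open>H2_L2_norm_eq_energy\<close>).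

  This expression is differentiated along straight lines in the space of diagonal models, with a
  Leibniz rule for the kernel (\<open>energy_has_vector_derivative\<close>). At an optimum the derivative vanishes
  in every direction (\<open>optimal_half_variation_eq_0\<close>). If only the pole \<open>\<lambda>\<^sub>i\<close> and its residue move, the
  inner products with the fraction at \<open>\<lambda>\<^sub>i\<close> evaluate the kernel sums at the reflected end points
  \<open>- cnj (\<lambda>\<^sub>i a)\<close> and \<open>- cnj (\<lambda>\<^sub>i b)\<close>, that is, they evaluate \<open>G - Gh\<close> there
  (\<open>half_variation_single\<close>). Varying the column of \<open>Ch\<close> gives the right tangential condition, varying
  the row of \<open>Bh\<close> the left one. An affine pole can be moved at \<open>a\<close> while it stays fixed at \<open>b\<close>, and
  conversely, which yields the conditions on the two partial derivatives
  (\<open>optimal_interpolation\<close>).\<close>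

section \<open>Square integrals of simple fractions on the imaginary axis\<close>

text \<open>With \<open>\<mu> = x + \<i>y\<close> the integrand is \<open>1 / (x\<^sup>2 + (\<omega> - y)\<^sup>2)\<close>, an affine substitution away from the
  Cauchy density \<open>1 / (1 + t\<^sup>2)\<close>.\<close>

lemma integrable_inverse_norm_square:
  fixes \<mu> :: complex
  assumes "Re \<mu> < 0"
  shows "integrable lborel (\<lambda>\<omega>. inverse ((norm (\<i> * of_real \<omega> - \<mu>))\<^sup>2))"
proof -
  define x where "x = Re \<mu>"
  define y where "y = Im \<mu>"
  have x: "x < 0" using assms by (simp add: x_def)
  have "integrable lborel (\<lambda>\<omega>::real. inverse (1 + \<omega>\<^sup>2))"
    using integrable_inverse_1_plus_square by (simp add: set_integrable_def)
  from lborel_integrable_real_affine[OF this, of "1/x" "-y/x"] x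
  have "integrable lborel (\<lambda>\<omega>. inverse (1 + (- y / x + 1 / x * \<omega>)\<^sup>2))" by simp
  moreover have "inverse ((norm (\<i> * of_real \<omega> - \<mu>))\<^sup>2)
      = inverse (x\<^sup>2) * inverse (1 + (- y / x + 1 / x * \<omega>)\<^sup>2)" for \<omega>
  proof -
    have "x\<^sup>2 * (1 + (- y / x + 1 / x * \<omega>)\<^sup>2) = x\<^sup>2 + (\<omega> - y)\<^sup>2"
      using x by (simp add: field_simps power2_eq_square)
    also have "\<dots> = (norm (\<i> * of_real \<omega> - \<mu>))\<^sup>2"
      by (simp add: cmod_power2 x_def y_def)
    finally show ?thesis by (metis inverse_mult_distrib)
  qed
  ultimately show ?thesis by simp
qed

lemma stable_pole_nonzero_difference:
  assumes "Re \<mu> < 0" "Re s \<ge> 0"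
  shows "s - \<mu> \<noteq> 0"
  using assms by auto

lemma continuous_simple_fraction:
  assumes "Re \<mu> < 0"
  shows "continuous_on UNIV (\<lambda>\<omega>. 1 / (\<i> * complex_of_real \<omega> - \<mu>))"
  by (intro continuous_intros) (use stable_pole_nonzero_difference[OF assms] in auto)

text \<open>A product of two moduli is at most the sum of their squares; this absolute version also supplies
  the integrable majorant for membership in the Hardy space.\<close>

lemma integrable_norm_simple_fraction_product:
  assumes "Re \<mu> < 0" "Re \<nu> < 0"
  shows "integrable lborel
    (\<lambda>\<omega>. norm (1 / (\<i> * complex_of_real \<omega> - \<mu>)) * norm (1 / (\<i> * complex_of_real \<omega> - \<nu>)))"
proof (rule Bochner_Integration.integrable_bound)
  show "integrable lborel (\<lambda>\<omega>. inverse ((norm (\<i> * complex_of_real \<omega> - \<mu>))\<^sup>2)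
      + inverse ((norm (\<i> * complex_of_real \<omega> - \<nu>))\<^sup>2))"
    using assms by (intro Bochner_Integration.integrable_add integrable_inverse_norm_square)
  show "(\<lambda>\<omega>. norm (1 / (\<i> * complex_of_real \<omega> - \<mu>)) * norm (1 / (\<i> * complex_of_real \<omega> - \<nu>)))
      \<in> borel_measurable lborel"
    by measurable
  have am: "\<bar>x * y\<bar> \<le> x\<^sup>2 + y\<^sup>2" for x y :: real
    using sum_squares_bound[of "\<bar>x\<bar>" "\<bar>y\<bar>"] mult_nonneg_nonneg[of "\<bar>x\<bar>" "\<bar>y\<bar>"]
    unfolding abs_mult power2_abs by linarith
  show "AE \<omega> in lborel. norm (norm (1 / (\<i> * complex_of_real \<omega> - \<mu>)) *
        norm (1 / (\<i> * complex_of_real \<omega> - \<nu>)))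
      \<le> norm (inverse ((norm (\<i> * complex_of_real \<omega> - \<mu>))\<^sup>2)
        + inverse ((norm (\<i> * complex_of_real \<omega> - \<nu>))\<^sup>2))"
  proof (intro AE_I2)
    fix \<omega>
    show "norm (norm (1 / (\<i> * complex_of_real \<omega> - \<mu>)) *
        norm (1 / (\<i> * complex_of_real \<omega> - \<nu>)))
      \<le> norm (inverse ((norm (\<i> * complex_of_real \<omega> - \<mu>))\<^sup>2)
        + inverse ((norm (\<i> * complex_of_real \<omega> - \<nu>))\<^sup>2))"
      using am[of "norm (1 / (\<i> * complex_of_real \<omega> - \<mu>))" "norm (1 / (\<i> * complex_of_real \<omega> - \<nu>))"]
      by (simp add: norm_divide power_divide inverse_eq_divide)
  qed
qed

lemma integrable_simple_fraction_product:
  assumes "Re \<mu> < 0" "Re \<nu> < 0"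
  shows "integrable lborel
    (\<lambda>\<omega>. 1 / (\<i> * complex_of_real \<omega> - \<mu>) * cnj (1 / (\<i> * complex_of_real \<omega> - \<nu>)))"
proof (rule Bochner_Integration.integrable_bound
      [OF integrable_norm_simple_fraction_product[OF assms]])
  show "(\<lambda>\<omega>. 1 / (\<i> * complex_of_real \<omega> - \<mu>) * cnj (1 / (\<i> * complex_of_real \<omega> - \<nu>)))
      \<in> borel_measurable lborel"
    using assms
    unfolding measurable_lborel2
    by (intro borel_measurable_continuous_onI continuous_on_mult continuous_on_cnj
        continuous_simple_fraction)
  show "AE \<omega> in lborel. norm (1 / (\<i> * complex_of_real \<omega> - \<mu>) * cnj (1 / (\<i> * complex_of_real \<omega> - \<nu>)))
      \<le> norm (norm (1 / (\<i> * complex_of_real \<omega> - \<mu>)) * norm (1 / (\<i> * complex_of_real \<omega> - \<nu>)))"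
    by (simp only: norm_mult complex_mod_cnj real_norm_def) simp
qed

text \<open>For large \<open>x\<close> both logarithms contain the same real part \<open>ln x\<close>, which cancels; what remains
  tends to \<open>Ln \<epsilon> - Ln (- \<epsilon>)\<close>. The cases \<open>\<epsilon> = \<i>\<close> and \<open>\<epsilon> = - \<i>\<close> are the two ends of the imaginary axis.\<close>

lemma Ln_shift_difference_limit:
  fixes \<epsilon> p q :: complex
  assumes p: "Re p > 0" and q: "Re q > 0" and \<epsilon>: "\<epsilon> = \<i> \<or> \<epsilon> = - \<i>"
  shows "((\<lambda>x. Ln (\<epsilon> * complex_of_real x + p) - Ln (- \<epsilon> * complex_of_real x + q))
           \<longlongrightarrow> \<epsilon> * pi) at_top"
proof -
  have lim: "((\<lambda>x. Ln (\<delta> + r / complex_of_real x)) \<longlongrightarrow> Ln \<delta>) at_top"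
    if "\<delta> = \<i> \<or> \<delta> = - \<i>" for \<delta> r
  proof (rule tendsto_Ln)
    have "((\<lambda>x. r / complex_of_real x) \<longlongrightarrow> 0) at_top"
      by (rule tendsto_divide_0[OF tendsto_const]) (rule filterlim_of_real_at_infinity)
    from tendsto_add[OF tendsto_const this, of \<delta>]
    show "((\<lambda>x. \<delta> + r / complex_of_real x) \<longlongrightarrow> \<delta>) at_top" by simp
    show "\<delta> \<notin> \<real>\<^sub>\<le>\<^sub>0" using that by (auto simp: complex_nonpos_Reals_iff)
  qed
  have eq: "Ln (\<delta> * complex_of_real x + r) = Ln (\<delta> + r / complex_of_real x) + ln x"
    if "x > 0" "Re r > 0" "\<delta> = \<i> \<or> \<delta> = - \<i>" for \<delta> r x
  proof -
    have "\<delta> * complex_of_real x + r = of_real x * (\<delta> + r / complex_of_real x)"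
      using that by (simp add: field_simps)
    moreover have "Re (\<delta> + r / complex_of_real x) > 0"
      using that by (auto simp: Re_divide_of_real)
    then have "\<delta> + r / complex_of_real x \<noteq> 0" by (metis less_irrefl zero_complex.simps(1))
    ultimately show ?thesis using that by (simp add: Ln_times_of_real Ln_of_real add.commute)
  qed
  have "Ln \<epsilon> - Ln (- \<epsilon>) = \<epsilon> * pi"
    using \<epsilon> by (auto simp: algebra_simps)
  moreover have "((\<lambda>x. Ln (\<epsilon> + p / complex_of_real x) - Ln (- \<epsilon> + q / complex_of_real x))
           \<longlongrightarrow> Ln \<epsilon> - Ln (- \<epsilon>)) at_top"
    using \<epsilon> by (intro tendsto_diff lim) auto
  moreover have "\<forall>\<^sub>F x in at_top. Ln (\<epsilon> + p / complex_of_real x) - Ln (- \<epsilon> + q / complex_of_real x)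
     = Ln (\<epsilon> * complex_of_real x + p) - Ln (- \<epsilon> * complex_of_real x + q)"
    using eventually_gt_at_top[of 0]
  proof eventually_elim
    case (elim x)
    show ?case
      using eq[of x p \<epsilon>] eq[of x q "-\<epsilon>"] elim p q \<epsilon> by (auto simp: algebra_simps)
  qed
  ultimately show ?thesis by (simp add: tendsto_cong)
qed

text \<open>The inner product of two simple fractions in the Hardy space, up to the factor \<open>2\<pi>\<close>. Partial
  fractions give a logarithmic antiderivative, and each end of the axis contributes a quarter turn
  of each of the two logarithms.\<close>

lemma integral_simple_fraction_product:
  assumes \<mu>: "Re \<mu> < 0" and \<nu>: "Re \<nu> < 0"
  shows "(\<integral>\<omega>. 1 / (\<i> * complex_of_real \<omega> - \<mu>) * cnj (1 / (\<i> * complex_of_real \<omega> - \<nu>)) \<partial>lborel)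
    = 2 * pi / (- (\<mu> + cnj \<nu>))"
proof -
  define w where "w = - (\<mu> + cnj \<nu>)"
  have "Re w > 0" using \<mu> \<nu> by (simp add: w_def)
  then have w: "w \<noteq> 0" by auto
  \<comment> \<open>The integrand is \<open>1 / (P Q)\<close> with \<open>P = \<i>\<omega> - \<mu>\<close>, \<open>Q = - \<i>\<omega> - cnj \<nu>\<close> and \<open>P + Q = w\<close>,
    so it equals \<open>(1 / P + 1 / Q) / w\<close>.\<close>
  define A where "A = (\<lambda>x. - \<i> / w *
    (Ln (\<i> * complex_of_real x - \<mu>) - Ln (- \<i> * complex_of_real x - cnj \<nu>)))"
  define f where "f = (\<lambda>\<omega>. 1 / (\<i> * complex_of_real \<omega> - \<mu>) * cnj (1 / (\<i> * complex_of_real \<omega> - \<nu>)))"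
  have nz: "\<i> * complex_of_real x - \<mu> \<noteq> 0" "- (\<i> * complex_of_real x) - cnj \<nu> \<noteq> 0"
      "\<i> * complex_of_real x - \<nu> \<noteq> 0" for x
    using stable_pole_nonzero_difference[OF \<mu>, of "\<i> * complex_of_real x"]
      stable_pole_nonzero_difference[OF \<nu>, of "\<i> * complex_of_real x"]
      stable_pole_nonzero_difference[of "cnj \<nu>" "- (\<i> * complex_of_real x)"] \<nu> by auto
  have deriv: "(A has_vector_derivative f x) (at x)" for x
  proof -
    have "((\<lambda>z. - \<i> / w * (Ln (\<i> * z - \<mu>) - Ln (- \<i> * z - cnj \<nu>))) has_field_derivative
        - \<i> / w * (\<i> / (\<i> * of_real x - \<mu>) + \<i> / (- \<i> * of_real x - cnj \<nu>))) (at (of_real x))"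
      using \<mu> \<nu> nz[of x] w
      by (auto intro!: derivative_eq_intros simp: complex_nonpos_Reals_iff divide_simps)
    moreover have "- \<i> / w * (\<i> / (\<i> * of_real x - \<mu>) + \<i> / (- \<i> * of_real x - cnj \<nu>)) = f x"
    proof -
      define P where "P = \<i> * complex_of_real x - \<mu>"
      define Q where "Q = - (\<i> * complex_of_real x) - cnj \<nu>"
      have PQ: "P \<noteq> 0" "Q \<noteq> 0" using nz[of x] by (auto simp: P_def Q_def)
      have w': "w = P + Q" by (simp add: w_def P_def Q_def)
      have "f x = 1 / (P * Q)" by (simp add: f_def P_def Q_def)
      moreover have "- \<i> / w * (\<i> / P + \<i> / Q) = (P + Q) / w / (P * Q)"
        using PQ w by (simp add: divide_simps) (simp add: algebra_simps)
      ultimately show ?thesis using w by (simp add: w' P_def Q_def)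
    qed
    ultimately show ?thesis
      unfolding A_def by (auto dest: has_vector_derivative_real_field)
  qed
  have "(LBINT x=-\<infinity>..\<infinity>. f x) = - \<i> / w * (\<i> * pi) - - \<i> / w * (- \<i> * pi)"
  proof (rule interval_integral_FTC_integrable)
    show "(A has_vector_derivative f x) (at x)" for x by (rule deriv)
    show "isCont f x" for x
      using nz[of x] unfolding f_def complex_cnj_divide complex_cnj_one
      by (auto intro!: continuous_intros simp flip: complex_cnj_diff)
    show "set_integrable lborel (einterval (- \<infinity>) \<infinity>) f"
      using integrable_simple_fraction_product[OF assms] by (simp add: set_integrable_def f_def)
    have "(A \<longlongrightarrow> - \<i> / w * (\<i> * pi)) at_top"
      using Ln_shift_difference_limit[of "-\<mu>" "-cnj \<nu>" \<i>] \<mu> \<nu>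
      unfolding A_def by (intro tendsto_mult_left) simp
    then show "((A \<circ> real_of_ereal) \<longlongrightarrow> - \<i> / w * (\<i> * pi)) (at_left \<infinity>)"
      by (simp only: ereal_tendsto_simps)
    have "(A \<longlongrightarrow> - \<i> / w * (- \<i> * pi)) at_bot"
      using Ln_shift_difference_limit[of "-\<mu>" "-cnj \<nu>" "-\<i>"] \<mu> \<nu>
      unfolding A_def filterlim_at_bot_mirror by (intro tendsto_mult_left) simp
    then show "((A \<circ> real_of_ereal) \<longlongrightarrow> - \<i> / w * (- \<i> * pi)) (at_right (-\<infinity>))"
      by (simp only: ereal_tendsto_simps)
  qed auto
  then show ?thesis
    by (simp add: interval_lebesgue_integral_def set_lebesgue_integral_def f_def w_def)
qed

section \<open>The Frobenius inner product and pole-residue functions\<close>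

definition frob :: "complex^'m^'p \<Rightarrow> complex^'m^'p \<Rightarrow> complex" where
  "frob M N = (\<Sum>i\<in>UNIV. \<Sum>j\<in>UNIV. M $ i $ j * cnj (N $ i $ j))"

lemma frob_self: "frob M M = complex_of_real ((norm M)\<^sup>2)"
  unfolding frob_def norm_vec_def L2_set_def
  by (simp add: sum_nonneg complex_norm_square del: of_real_power)

lemma frob_cnj: "cnj (frob M N) = frob N M"
  by (simp add: frob_def mult.commute)

lemma frob_sum_left: "frob (sum f A) N = (\<Sum>x\<in>A. frob (f x) N)"
proof -
  have "frob (sum f A) N = (\<Sum>i\<in>UNIV. \<Sum>j\<in>UNIV. \<Sum>x\<in>A. f x $ i $ j * cnj (N $ i $ j))"
    by (simp add: frob_def sum_distrib_right)
  also have "\<dots> = (\<Sum>i\<in>UNIV. \<Sum>x\<in>A. \<Sum>j\<in>UNIV. f x $ i $ j * cnj (N $ i $ j))"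
    by (intro sum.cong refl sum.swap)
  also have "\<dots> = (\<Sum>x\<in>A. frob (f x) N)"
    unfolding frob_def by (rule sum.swap)
  finally show ?thesis .
qed

lemma frob_sum_right: "frob M (sum f A) = (\<Sum>x\<in>A. frob M (f x))"
  by (subst (1 2) frob_cnj[symmetric]) (simp add: frob_sum_left)

lemma frob_cscale_left: "frob (cscale z M) N = z * frob M N"
  by (simp add: frob_def cscale_def map_matrix_def sum_distrib_left mult.assoc)

lemma frob_cscale_right: "frob M (cscale z N) = cnj z * frob M N"
  by (subst (1 2) frob_cnj[symmetric]) (simp add: frob_cscale_left)

lemma norm_cscale: "norm (cscale z M) = norm z * norm M"
proof (rule power2_eq_imp_eq)
  have "complex_of_real ((norm (cscale z M))\<^sup>2) = z * cnj z * frob M M"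
    unfolding frob_self[symmetric] frob_cscale_left frob_cscale_right by (simp only: mult_ac)
  also have "\<dots> = complex_of_real ((norm z * norm M)\<^sup>2)"
    by (simp only: frob_self complex_norm_square[symmetric] power_mult_distrib of_real_mult)
  finally show "(norm (cscale z M))\<^sup>2 = (norm z * norm M)\<^sup>2" by (simp only: of_real_eq_iff)
qed auto

text \<open>The poles may coincide; this is what makes the difference of two models, with the poles of both,
  again of this form.\<close>

definition pole_residue :: "('k::finite \<Rightarrow> complex) \<Rightarrow> ('k \<Rightarrow> complex^'m^'p) \<Rightarrow> complex \<Rightarrow> complex^'m^'p" where
  "pole_residue \<mu> M s = (\<Sum>k\<in>UNIV. cscale (1 / (s - \<mu> k)) (M k))"

lemma pole_residue_component:
  "pole_residue \<mu> M s $ i $ j = (\<Sum>k\<in>UNIV. 1 / (s - \<mu> k) * M k $ i $ j)"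
  by (simp add: pole_residue_def cscale_def map_matrix_def)

text \<open>The hypothesis on \<open>F\<close> is confined to the open half-plane because a transfer function, being
  defined through a matrix inverse, has its pole-residue form only away from the poles.\<close>

lemma boundary_value_pole_residue:
  fixes F :: "complex \<Rightarrow> complex^'m^'p"
  assumes stable: "\<And>k. Re (\<mu> k) < 0"
    and F: "\<And>s. Re s > 0 \<Longrightarrow> F s = pole_residue \<mu> M s"
  shows "boundary_value F \<omega> = pole_residue \<mu> M (\<i> * of_real \<omega>)"
  unfolding boundary_value_def
proof (rule tendsto_Lim)
  have "((\<lambda>x. pole_residue \<mu> M (Complex x \<omega>)) \<longlongrightarrow> pole_residue \<mu> M (\<i> * of_real \<omega>)) (at_right 0)"
  proof (intro vec_tendstoI, unfold pole_residue_component)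
    fix i j
    have "((\<lambda>x. of_real x + \<i> * of_real \<omega>) \<longlongrightarrow> of_real 0 + \<i> * of_real \<omega>) (at_right (0::real))"
      by (intro tendsto_intros)
    then have 1: "((\<lambda>x. Complex x \<omega>) \<longlongrightarrow> \<i> * of_real \<omega>) (at_right (0::real))"
      by (simp add: Complex_eq)
    have "\<i> * of_real \<omega> - \<mu> k \<noteq> 0" for k
      by (rule stable_pole_nonzero_difference) (use stable in auto)
    then show "((\<lambda>x. \<Sum>k\<in>UNIV. 1 / (Complex x \<omega> - \<mu> k) * M k $ i $ j) \<longlongrightarrow>
        (\<Sum>k\<in>UNIV. 1 / (\<i> * of_real \<omega> - \<mu> k) * M k $ i $ j)) (at_right 0)"
      by (intro tendsto_intros 1) auto
  qed
  moreover have "\<forall>\<^sub>F x in at_right 0. pole_residue \<mu> M (Complex x \<omega>) = F (Complex x \<omega>)"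
    unfolding eventually_at_right_field by (intro exI[of _ 1]) (simp add: F)
  ultimately show "((\<lambda>x. F (Complex x \<omega>)) \<longlongrightarrow> pole_residue \<mu> M (\<i> * of_real \<omega>)) (at_right 0)"
    by (rule Lim_transform_eventually)
qed simp

lemma norm_square_pole_residue:
  "complex_of_real ((norm (pole_residue \<mu> M s))\<^sup>2) =
     (\<Sum>k\<in>UNIV. \<Sum>l\<in>UNIV. frob (M k) (M l) * (1 / (s - \<mu> k) * cnj (1 / (s - \<mu> l))))"
  unfolding frob_self[symmetric] pole_residue_def frob_sum_left
  by (simp only: frob_sum_right frob_cscale_left frob_cscale_right mult_ac)

text \<open>The Gram matrix of the simple fractions \<open>1 / (s - \<mu> k)\<close> has the entries
  \<open>- 1 / (\<mu> k + cnj (\<mu> l))\<close>.\<close>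

lemma H2_norm_pole_residue:
  fixes F :: "complex \<Rightarrow> complex^'m^'p"
  assumes stable: "\<And>k. Re (\<mu> k) < 0"
    and F: "\<And>s. Re s > 0 \<Longrightarrow> F s = pole_residue \<mu> M s"
  shows "complex_of_real ((H2_norm F)\<^sup>2) =
    (\<Sum>k\<in>UNIV. \<Sum>l\<in>UNIV. frob (M k) (M l) * (1 / (- (\<mu> k + cnj (\<mu> l)))))"
proof -
  define g where "g = (\<lambda>k l \<omega>. 1 / (\<i> * complex_of_real \<omega> - \<mu> k) * cnj (1 / (\<i> * complex_of_real \<omega> - \<mu> l)))"
  have g: "integrable lborel (g k l)" for k l
    unfolding g_def by (rule integrable_simple_fraction_product) (rule stable)+
  have gi: "integral\<^sup>L lborel (g k l) = 2 * pi / (- (\<mu> k + cnj (\<mu> l)))" for k l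
    unfolding g_def by (rule integral_simple_fraction_product) (rule stable)+
  have bv: "boundary_value F = (\<lambda>\<omega>. pole_residue \<mu> M (\<i> * of_real \<omega>))"
    by (intro ext boundary_value_pole_residue stable F)
  have "complex_of_real ((H2_norm F)\<^sup>2) =
      1 / (2 * pi) * (\<integral>\<omega>. complex_of_real ((norm (pole_residue \<mu> M (\<i> * of_real \<omega>)))\<^sup>2) \<partial>lborel)"
    unfolding H2_norm_def bv integral_complex_of_real
    by (subst real_sqrt_pow2) (auto intro!: divide_nonneg_pos integral_nonneg)
  also have "\<dots> = 1 / (2 * pi) * (\<integral>\<omega>. (\<Sum>k\<in>UNIV. \<Sum>l\<in>UNIV. frob (M k) (M l) * g k l \<omega>) \<partial>lborel)"
    unfolding norm_square_pole_residue g_def ..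
  also have "\<dots> = 1 / (2 * pi) * (\<Sum>k\<in>UNIV. \<Sum>l\<in>UNIV. frob (M k) (M l) * integral\<^sup>L lborel (g k l))"
    using g by (simp add: Bochner_Integration.integral_sum)
  also have "\<dots> = (\<Sum>k\<in>UNIV. \<Sum>l\<in>UNIV. frob (M k) (M l) * (1 / (- (\<mu> k + cnj (\<mu> l)))))"
    unfolding gi sum_distrib_left by (intro sum.cong refl) (simp add: field_simps)
  finally show ?thesis .
qed

text \<open>Moving from the imaginary axis to the right increases the distance to every stable pole, so the
  sum of the moduli on the axis bounds the function on each vertical line.\<close>

lemma pole_residue_in_hardy_H2:
  fixes F :: "complex \<Rightarrow> complex^'m^'p"
  assumes stable: "\<And>k. Re (\<mu> k) < 0"
    and F: "\<And>s. Re s > 0 \<Longrightarrow> F s = pole_residue \<mu> M s"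
  shows "F \<in> hardy_H2"
proof -
  define g where "g = (\<lambda>\<omega>. (\<Sum>k\<in>UNIV. norm (1 / (\<i> * complex_of_real \<omega> - \<mu> k)) * norm (M k))\<^sup>2)"
  have g_eq: "g \<omega> = (\<Sum>k\<in>UNIV. \<Sum>l\<in>UNIV. (norm (1 / (\<i> * complex_of_real \<omega> - \<mu> k)) *
      norm (1 / (\<i> * complex_of_real \<omega> - \<mu> l))) * (norm (M k) * norm (M l)))" for \<omega>
    unfolding g_def power2_eq_square sum_product by (simp only: mult_ac)
  have "integrable lborel g"
    unfolding g_eq[abs_def]
    by (intro Bochner_Integration.integrable_sum integrable_mult_left
        integrable_norm_simple_fraction_product stable)
  then have fin: "(\<integral>\<^sup>+\<omega>. ennreal (g \<omega>) \<partial>lborel) < \<infinity>"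
    by (subst nn_integral_eq_integral) (auto simp: g_def)
  have "(\<integral>\<^sup>+\<omega>. ennreal ((norm (F (Complex x \<omega>)))\<^sup>2) \<partial>lborel) \<le> (\<integral>\<^sup>+\<omega>. ennreal (g \<omega>) \<partial>lborel)"
    if "x > 0" for x
  proof (intro nn_integral_mono ennreal_leI)
    fix \<omega>
    have *: "norm (1 / (Complex x \<omega> - \<mu> k)) \<le> norm (1 / (\<i> * complex_of_real \<omega> - \<mu> k))" for k
    proof -
      have "(norm (\<i> * complex_of_real \<omega> - \<mu> k))\<^sup>2 \<le> (norm (Complex x \<omega> - \<mu> k))\<^sup>2"
      proof -
        have "(- Re (\<mu> k))\<^sup>2 \<le> (x - Re (\<mu> k))\<^sup>2"
          using stable[of k] that by (intro power_mono) auto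
        then show ?thesis by (simp add: cmod_power2)
      qed
      then have "norm (\<i> * complex_of_real \<omega> - \<mu> k) \<le> norm (Complex x \<omega> - \<mu> k)"
        by simp
      moreover have "norm (\<i> * complex_of_real \<omega> - \<mu> k) > 0"
        using stable_pole_nonzero_difference[OF stable[of k], of "\<i> * complex_of_real \<omega>"] by simp
      ultimately show ?thesis unfolding norm_divide by (intro frac_le) auto
    qed
    have "norm (F (Complex x \<omega>)) \<le> (\<Sum>k\<in>UNIV. norm (1 / (Complex x \<omega> - \<mu> k)) * norm (M k))"
      unfolding F[of "Complex x \<omega>", simplified, OF that] pole_residue_def
      by (rule order_trans[OF norm_sum]) (simp only: norm_cscale order_refl)
    also have "\<dots> \<le> (\<Sum>k\<in>UNIV. norm (1 / (\<i> * complex_of_real \<omega> - \<mu> k)) * norm (M k))"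
      by (intro sum_mono mult_right_mono *) auto
    finally show "(norm (F (Complex x \<omega>)))\<^sup>2 \<le> g \<omega>"
      unfolding g_def by (intro power_mono) auto
  qed
  then have "(SUP x\<in>{0<..}. \<integral>\<^sup>+\<omega>. ennreal ((norm (F (Complex x \<omega>)))\<^sup>2) \<partial>lborel)
      \<le> (\<integral>\<^sup>+\<omega>. ennreal (g \<omega>) \<partial>lborel)"
    by (intro SUP_least) auto
  moreover have "(\<lambda>s. F s $ i $ j) holomorphic_on {s. Re s > 0}" for i j
  proof -
    have "(\<lambda>s. pole_residue \<mu> M s $ i $ j) holomorphic_on {s. Re s > 0}"
      unfolding pole_residue_component
      by (intro holomorphic_intros) (use stable_pole_nonzero_difference[OF stable] in auto)
    then show ?thesis
      by (rule holomorphic_transform) (simp add: F)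
  qed
  ultimately show ?thesis
    using fin unfolding hardy_H2_def by (auto intro: le_less_trans)
qed

section \<open>The logarithmic kernel as an integral along a chord\<close>

text \<open>The affine function of \<open>q\<close> with the values \<open>u\<close> at \<open>a\<close> and \<open>v\<close> at \<open>b\<close>. An affine pole is
  determined by its two end values, which are the variables of the kernel.\<close>

definition chord :: "real \<Rightarrow> real \<Rightarrow> complex \<Rightarrow> complex \<Rightarrow> real \<Rightarrow> complex" where
  "chord a b u v q = (of_real (b - q) * u + of_real (q - a) * v) / of_real (b - a)"

text \<open>This integral is the logarithmic kernel in a form without case distinction at the removable
  singularity, so that it can be differentiated under the integral sign.\<close>

definition line_kernel :: "real \<Rightarrow> real \<Rightarrow> complex \<Rightarrow> complex \<Rightarrow> complex" where
  "line_kernel a b u v = integral {a..b} (\<lambda>q. 1 / chord a b u v q)"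

text \<open>The derivative of \<^const>\<open>line_kernel\<close> at \<open>(u, v)\<close> in the direction \<open>(h, k)\<close>.\<close>

definition line_kernel_deriv ::
    "real \<Rightarrow> real \<Rightarrow> complex \<Rightarrow> complex \<Rightarrow> complex \<Rightarrow> complex \<Rightarrow> complex" where
  "line_kernel_deriv a b u v h k = - integral {a..b} (\<lambda>q. chord a b h k q / (chord a b u v q)\<^sup>2)"

lemma affine_eq_chord:
  assumes "a < b"
  shows "u + of_real q * v = chord a b (u + of_real a * v) (u + of_real b * v) q"
proof -
  have "complex_of_real (b - a) \<noteq> 0" using assms by (simp only: of_real_eq_0_iff)
  then show ?thesis
    unfolding chord_def by (simp add: eq_divide_eq) (simp add: algebra_simps)
qed

lemma chord_lincomb:
  "chord a b (u + z * h) (v + z * k) q = chord a b u v q + z * chord a b h k q"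
  unfolding chord_def times_divide_eq_right add_divide_distrib[symmetric]
  by (simp add: algebra_simps)

lemma chord_add: "chord a b (u + h) (v + k) q = chord a b u v q + chord a b h k q"
  using chord_lincomb[of a b u 1 h v k] by simp

lemma chord_scale: "chord a b (z * h) (z * k) q = z * chord a b h k q"
  using chord_lincomb[of a b 0 z h 0 k] by (simp add: chord_def)

lemma chord_cnj: "chord a b (cnj u) (cnj v) q = cnj (chord a b u v q)"
  by (simp add: chord_def)

lemma continuous_on_chord [continuous_intros]:
  assumes "continuous_on S u" "continuous_on S v" "continuous_on S q" "a < b"
  shows "continuous_on S (\<lambda>x. chord a b (u x) (v x) (q x))"
  unfolding chord_def by (intro continuous_intros assms) (use assms in auto)

lemma Re_chord_pos:
  assumes "a < b" "q \<in> {a..b}" "Re u > 0" "Re v > 0"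
  shows "Re (chord a b u v q) > 0"
proof -
  have "(b - q) * Re u + (q - a) * Re v > 0"
  proof (cases "q = a")
    case True
    then show ?thesis using assms by simp
  next
    case False
    then have "(q - a) * Re v > 0" "(b - q) * Re u \<ge> 0" using assms by auto
    then show ?thesis by simp
  qed
  moreover have "Re (chord a b u v q) = ((b - q) * Re u + (q - a) * Re v) / (b - a)"
    unfolding chord_def Re_divide_of_real by simp
  ultimately show ?thesis using assms by simp
qed

lemma chord_nonzero:
  assumes "a < b" "q \<in> {a..b}" "Re u > 0" "Re v > 0"
  shows "chord a b u v q \<noteq> 0"
  using Re_chord_pos[OF assms] by auto

text \<open>In the right half-plane the two arguments lie in \<open>(-\<pi>/2, \<pi>/2)\<close>, so their difference does not
  leave the principal range.\<close>

lemma Ln_quotient_right_half_plane: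
  assumes "Re u > 0" "Re v > 0"
  shows "Ln (v / u) = Ln v - Ln u"
proof -
  have "u \<noteq> 0" "v \<noteq> 0" using assms by auto
  then have "exp (Ln v - Ln u) = v / u" by (simp add: exp_diff)
  moreover have "Ln (exp (Ln v - Ln u)) = Ln v - Ln u"
    using Re_Ln_pos_lt_imp[OF assms(1)] Re_Ln_pos_lt_imp[OF assms(2)]
    by (intro Ln_exp) auto
  ultimately show ?thesis by simp
qed

text \<open>The logarithm of the chord, divided by the slope, is an antiderivative of its reciprocal. At the
  removable singularity the chord is constant.\<close>

lemma f_kernel_eq_line_kernel:
  assumes ab: "a < b" and pos: "Re (sa - \<sigma>a) > 0" "Re (sb - \<sigma>b) > 0"
  shows "f_kernel a b \<sigma>a \<sigma>b sa sb = line_kernel a b (sa - \<sigma>a) (sb - \<sigma>b)"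
proof -
  define u v where "u = sa - \<sigma>a" and "v = sb - \<sigma>b"
  have uv: "Re u > 0" "Re v > 0" using pos by (auto simp: u_def v_def)
  have ba: "complex_of_real (b - a) \<noteq> 0" using ab by (simp only: of_real_eq_0_iff)
  show ?thesis
  proof (cases "v = u")
    case True
    have "chord a b u u q = u" for q
      using ba by (simp add: chord_def divide_eq_eq) (simp add: algebra_simps)
    then have "line_kernel a b u v = of_real (b - a) / u"
      using ab True by (simp add: line_kernel_def scaleR_conv_of_real)
    then show ?thesis using True by (simp add: f_kernel_def u_def v_def)
  next
    case False
    define D where "D = of_real (b - a) / (v - u)"
    have "((\<lambda>q. 1 / chord a b u v q) has_integral
        (D * Ln (chord a b u v b) - D * Ln (chord a b u v a))) {a..b}"
    proof (rule fundamental_theorem_of_calculus)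
      fix q assume q: "q \<in> {a..b}"
      have c: "Re (chord a b u v q) > 0" by (rule Re_chord_pos[OF ab q uv])
      define L where "L = (\<lambda>z. ((of_real b - z) * u + (z - of_real a) * v) / of_real (b - a))"
      have L: "(L has_field_derivative (v - u) / of_real (b - a)) (at (of_real q))"
        unfolding L_def by (intro DERIV_cdivide) (auto intro!: derivative_eq_intros)
      have Lq: "L (of_real x) = chord a b u v x" for x by (simp add: L_def chord_def)
      have "((\<lambda>z. D * Ln (L z)) has_field_derivative
          D * (((v - u) / of_real (b - a)) / chord a b u v q)) (at (of_real q))"
        using c by (intro DERIV_cmult)
          (auto intro!: derivative_eq_intros L simp: Lq complex_nonpos_Reals_iff divide_inverse mult_ac)
      moreover have "D * (((v - u) / of_real (b - a)) / chord a b u v q) = 1 / chord a b u v q"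
        using False ba by (simp add: D_def)
      ultimately show "((\<lambda>q. D * Ln (chord a b u v q)) has_vector_derivative 1 / chord a b u v q)
          (at q within {a..b})"
        unfolding Lq[symmetric]
        by (auto dest!: has_vector_derivative_real_field intro: has_vector_derivative_at_within)
    qed (use ab in auto)
    moreover have "chord a b u v b = v" "chord a b u v a = u"
      using ba by (auto simp: chord_def)
    ultimately have "line_kernel a b u v = D * (Ln v - Ln u)"
      unfolding line_kernel_def by (simp add: integral_unique right_diff_distrib)
    then show ?thesis
      using False by (simp add: f_kernel_def u_def v_def D_def Ln_quotient_right_half_plane[OF pos])
  qed
qed

lemma integrable_line_kernel:
  assumes "a < b" "Re u > 0" "Re v > 0"
  shows "(\<lambda>q. 1 / chord a b u v q) integrable_on {a..b}"
  using chord_nonzero[OF assms(1) _ assms(2,3)] assms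
  by (intro integrable_continuous_interval continuous_intros) auto

lemma integrable_line_kernel_deriv:
  assumes "a < b" "Re u > 0" "Re v > 0"
  shows "(\<lambda>q. chord a b h k q / (chord a b u v q)\<^sup>2) integrable_on {a..b}"
  using chord_nonzero[OF assms(1) _ assms(2,3)] assms
  by (intro integrable_continuous_interval continuous_intros) auto

text \<open>Differentiation under the integral sign on a disc that keeps both end points in the right
  half-plane. The partial derivatives of the kernel and the effect of moving poles are both
  special cases.\<close>

lemma line_kernel_has_field_derivative:
  assumes ab: "a < b" and uv: "Re u > 0" "Re v > 0"
  shows "((\<lambda>t. line_kernel a b (u + t * h) (v + t * k)) has_field_derivative
    line_kernel_deriv a b u v h k) (at 0)"
proof -
  define S where "S = {t. Re (u + t * h) > 0} \<inter> {t. Re (v + t * k) > 0}"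
  have "open S"
    unfolding S_def by (intro open_Int open_Collect_less continuous_intros)
  moreover have "0 \<in> S" using uv by (simp add: S_def)
  ultimately obtain e where e: "e > 0" "ball 0 e \<subseteq> S"
    by (meson open_contains_ball)
  have nz: "chord a b (u + t * h) (v + t * k) q \<noteq> 0" if "t \<in> ball 0 e" "q \<in> {a..b}" for t q
    using e that by (intro chord_nonzero[OF ab]) (auto simp: S_def)
  define f' where "f' = (\<lambda>t q. - chord a b h k q / (chord a b (u + t * h) (v + t * k) q)\<^sup>2)"
  have "((\<lambda>t. integral (cbox a b) (\<lambda>q. 1 / chord a b (u + t * h) (v + t * k) q))
     has_field_derivative integral (cbox a b) (f' 0)) (at 0 within ball 0 e)"
  proof (rule leibniz_rule_field_derivative)
    fix t q assume "t \<in> ball (0::complex) e" "q \<in> cbox a b"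
    then have "chord a b u v q + t * chord a b h k q \<noteq> 0"
      using nz[of t q] by (simp add: chord_lincomb)
    then show "((\<lambda>t. 1 / chord a b (u + t * h) (v + t * k) q) has_field_derivative f' t q)
        (at t within ball 0 e)"
      unfolding chord_lincomb f'_def
      by (auto intro!: derivative_eq_intros simp: power2_eq_square)
  next
    fix t assume "t \<in> ball (0::complex) e"
    then show "(\<lambda>q. 1 / chord a b (u + t * h) (v + t * k) q) integrable_on cbox a b"
      using e ab by (auto intro!: integrable_line_kernel simp: S_def)
  next
    show "continuous_on (ball 0 e \<times> cbox a b) (\<lambda>(t, q). f' t q)"
      unfolding f'_def split_beta using nz ab by (intro continuous_intros) auto
  qed (use e in auto)
  moreover have "integral {a..b} (f' 0) = line_kernel_deriv a b u v h k"
    unfolding line_kernel_deriv_def f'_def by (simp flip: integral_neg)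
  ultimately show ?thesis
    using e by (simp add: line_kernel_def at_within_open[of 0 "ball 0 e"])
qed

lemma line_kernel_cnj: "line_kernel a b (cnj u) (cnj v) = cnj (line_kernel a b u v)"
  by (simp add: line_kernel_def chord_cnj integral_cnj)

lemma line_kernel_deriv_cnj:
  "line_kernel_deriv a b (cnj u) (cnj v) (cnj h) (cnj k) = cnj (line_kernel_deriv a b u v h k)"
  by (simp add: line_kernel_deriv_def chord_cnj integral_cnj)

lemma line_kernel_deriv_add:
  assumes "a < b" "Re u > 0" "Re v > 0"
  shows "line_kernel_deriv a b u v (h + h') (k + k')
    = line_kernel_deriv a b u v h k + line_kernel_deriv a b u v h' k'"
  unfolding line_kernel_deriv_def chord_add add_divide_distrib
  using integrable_line_kernel_deriv[OF assms]
  by (subst integral_add) auto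

lemma line_kernel_deriv_scale:
  "line_kernel_deriv a b u v (z * h) (z * k) = z * line_kernel_deriv a b u v h k"
  unfolding line_kernel_deriv_def chord_scale times_divide_eq_right[symmetric]
  by (simp only: integral_mult_right mult_minus_right)

lemma f_kernel_has_derivative_sa:
  assumes ab: "a < b" and pos: "Re (sa - \<sigma>a) > 0" "Re (sb - \<sigma>b) > 0"
  shows "((\<lambda>s. f_kernel a b \<sigma>a \<sigma>b s sb) has_field_derivative
    line_kernel_deriv a b (sa - \<sigma>a) (sb - \<sigma>b) 1 0) (at sa)"
proof (rule has_field_derivative_transform_within_open)
  have "((\<lambda>s. line_kernel a b (sa - \<sigma>a + (s - sa) * 1) (sb - \<sigma>b + (s - sa) * 0)) has_field_derivative
    line_kernel_deriv a b (sa - \<sigma>a) (sb - \<sigma>b) 1 0 * 1) (at sa)"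
    using line_kernel_has_field_derivative[OF assms, of 1 0]
    by (intro DERIV_chain'[of "\<lambda>s. s - sa" 1 sa UNIV "\<lambda>t. line_kernel a b (sa - \<sigma>a + t * 1) (sb - \<sigma>b + t * 0)"])
       (auto intro!: derivative_eq_intros)
  then show "((\<lambda>s. line_kernel a b (s - \<sigma>a) (sb - \<sigma>b)) has_field_derivative
    line_kernel_deriv a b (sa - \<sigma>a) (sb - \<sigma>b) 1 0) (at sa)" by simp
  show "open {s. Re (s - \<sigma>a) > 0}"
    by (intro open_Collect_less continuous_intros)
qed (use assms in \<open>auto simp: f_kernel_eq_line_kernel\<close>)

lemma f_kernel_has_derivative_sb:
  assumes ab: "a < b" and pos: "Re (sa - \<sigma>a) > 0" "Re (sb - \<sigma>b) > 0"
  shows "((\<lambda>s. f_kernel a b \<sigma>a \<sigma>b sa s) has_field_derivative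
    line_kernel_deriv a b (sa - \<sigma>a) (sb - \<sigma>b) 0 1) (at sb)"
proof (rule has_field_derivative_transform_within_open)
  have "((\<lambda>s. line_kernel a b (sa - \<sigma>a + (s - sb) * 0) (sb - \<sigma>b + (s - sb) * 1)) has_field_derivative
    line_kernel_deriv a b (sa - \<sigma>a) (sb - \<sigma>b) 0 1 * 1) (at sb)"
    using line_kernel_has_field_derivative[OF assms, of 0 1]
    by (intro DERIV_chain'[of "\<lambda>s. s - sb" 1 sb UNIV "\<lambda>t. line_kernel a b (sa - \<sigma>a + t * 0) (sb - \<sigma>b + t * 1)"])
       (auto intro!: derivative_eq_intros)
  then show "((\<lambda>s. line_kernel a b (sa - \<sigma>a) (s - \<sigma>b)) has_field_derivative
    line_kernel_deriv a b (sa - \<sigma>a) (sb - \<sigma>b) 0 1) (at sb)" by simp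
  show "open {s. Re (s - \<sigma>b) > 0}"
    by (intro open_Collect_less continuous_intros)
qed (use assms in \<open>auto simp: f_kernel_eq_line_kernel\<close>)

section \<open>The squared error and its first variation\<close>

text \<open>The integral over \<open>[a, b]\<close> of the Gram matrix entry of the poles \<open>k\<close> and \<open>l\<close>, where \<open>za\<close> and \<open>zb\<close>
  are the values of the affine poles at the two ends.\<close>

definition pairing :: "real \<Rightarrow> real \<Rightarrow> ('k \<Rightarrow> complex) \<Rightarrow> ('k \<Rightarrow> complex) \<Rightarrow> 'k \<Rightarrow> 'k \<Rightarrow> complex" where
  "pairing a b za zb k l = line_kernel a b (- (za k + cnj (za l))) (- (zb k + cnj (zb l)))"

text \<open>The change of the pairing when the first pole alone moves, by \<open>ha\<close> at \<open>a\<close> and by \<open>hb\<close> at \<open>b\<close>.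
  The second pole enters conjugated, so a motion of it by \<open>ha\<close>, \<open>hb\<close> has the effect of \<open>cnj ha\<close>,
  \<open>cnj hb\<close> here.\<close>

definition pairing_deriv ::
    "real \<Rightarrow> real \<Rightarrow> ('k \<Rightarrow> complex) \<Rightarrow> ('k \<Rightarrow> complex) \<Rightarrow> 'k \<Rightarrow> 'k \<Rightarrow> complex \<Rightarrow> complex \<Rightarrow> complex" where
  "pairing_deriv a b za zb k l ha hb =
     line_kernel_deriv a b (- (za k + cnj (za l))) (- (zb k + cnj (zb l))) (- ha) (- hb)"

text \<open>This is the squared norm of the pole-residue function with affine poles: a finite expression in
  the residues and the end values of the poles.\<close>

definition energy ::
    "real \<Rightarrow> real \<Rightarrow> ('k::finite \<Rightarrow> complex) \<Rightarrow> ('k \<Rightarrow> complex) \<Rightarrow> ('k \<Rightarrow> complex^'m^'p) \<Rightarrow> complex" where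
  "energy a b za zb M = (\<Sum>k\<in>UNIV. \<Sum>l\<in>UNIV. frob (M k) (M l) * pairing a b za zb k l)"

lemma cnj_pairing: "cnj (pairing a b za zb k l) = pairing a b za zb l k"
  unfolding pairing_def line_kernel_cnj[symmetric] complex_cnj_minus complex_cnj_add complex_cnj_cnj
  by (simp only: add.commute)

lemma cnj_pairing_deriv:
  "cnj (pairing_deriv a b za zb k l ha hb) = pairing_deriv a b za zb l k (cnj ha) (cnj hb)"
  unfolding pairing_deriv_def line_kernel_deriv_cnj[symmetric] complex_cnj_minus complex_cnj_add
    complex_cnj_cnj
  by (simp only: add.commute)

text \<open>For fixed \<open>q\<close> the squared norm is a Gram sum, continuous in \<open>q\<close>; the sum of a pole and the
  conjugate of another is affine in \<open>q\<close> again, so integration turns each entry into the kernel.\<close>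

lemma H2_L2_norm_eq_energy:
  fixes E :: "complex \<Rightarrow> real \<Rightarrow> complex^'m^'p"
  assumes ab: "a < b"
    and za: "\<And>k. Re (za k) < 0" and zb: "\<And>k. Re (zb k) < 0"
    and E: "\<And>s q. Re s > 0 \<Longrightarrow> q \<in> {a..b} \<Longrightarrow> E s q = pole_residue (\<lambda>k. chord a b (za k) (zb k) q) M s"
  shows "H2_L2_norm a b E = ennreal (sqrt (Re (energy a b za zb M)))"
    and "Re (energy a b za zb M) \<ge> 0"
proof -
  define u where "u = (\<lambda>k l. - (za k + cnj (za l)))"
  define v where "v = (\<lambda>k l. - (zb k + cnj (zb l)))"
  have uv: "Re (u k l) > 0" "Re (v k l) > 0" for k l
    using za[of k] za[of l] zb[of k] zb[of l] by (auto simp: u_def v_def)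
  define g where "g = (\<lambda>q. \<Sum>k\<in>UNIV. \<Sum>l\<in>UNIV. frob (M k) (M l) * (1 / chord a b (u k l) (v k l) q))"
  have stable: "Re (chord a b (za k) (zb k) q) < 0" if "q \<in> {a..b}" for k q
    using Re_chord_pos[OF ab that, of "- za k" "- zb k"] za[of k] zb[of k]
      chord_scale[of a b "-1" "za k" "zb k" q] by simp
  have uv_eq: "- (chord a b (za k) (zb k) q + cnj (chord a b (za l) (zb l) q)) = chord a b (u k l) (v k l) q"
    for k l q
    using chord_scale[of a b "-1" "za k + cnj (za l)" "zb k + cnj (zb l)" q]
    by (simp add: u_def v_def chord_add chord_cnj)
  have norm_g: "(H2_norm (\<lambda>s. E s q))\<^sup>2 = Re (g q)" if q: "q \<in> {a..b}" for q
  proof -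
    have "complex_of_real ((H2_norm (\<lambda>s. E s q))\<^sup>2) = g q"
      unfolding g_def uv_eq[symmetric]
      by (rule H2_norm_pole_residue) (use stable E q in auto)
    then show ?thesis by (metis Re_complex_of_real)
  qed
  have hardy: "(\<lambda>s. E s q) \<in> hardy_H2" if q: "q \<in> {a..b}" for q
    by (rule pole_residue_in_hardy_H2[where \<mu> = "\<lambda>k. chord a b (za k) (zb k) q" and M = M])
       (use stable E q in auto)
  have int_g: "integrable (lebesgue_on {a..b}) g"
    unfolding g_def using chord_nonzero[OF ab _ uv] ab
    by (intro continuous_imp_integrable_real continuous_intros) auto
  have pairing_uv: "pairing a b za zb k l = integral {a..b} (\<lambda>q. 1 / chord a b (u k l) (v k l) q)"
    for k l
    by (simp add: pairing_def line_kernel_def u_def v_def)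
  have "integral\<^sup>L (lebesgue_on {a..b}) g = integral {a..b} g"
    by (rule lebesgue_integral_eq_integral[OF int_g]) simp
  also have "\<dots> = energy a b za zb M"
    unfolding g_def energy_def pairing_uv
    using integrable_line_kernel[OF ab uv]
    by (simp add: integral_sum integrable_sum integrable_on_mult_right integral_mult_right
        del: times_divide_eq_right)
  finally have int_eq: "integral\<^sup>L (lebesgue_on {a..b}) g = energy a b za zb M" .
  have sq: "(\<integral>q. (H2_norm (\<lambda>s. E s q))\<^sup>2 \<partial>lebesgue_on {a..b}) = Re (energy a b za zb M)"
  proof -
    have "(\<integral>q. (H2_norm (\<lambda>s. E s q))\<^sup>2 \<partial>lebesgue_on {a..b}) = (\<integral>q. Re (g q) \<partial>lebesgue_on {a..b})"
      by (intro Bochner_Integration.integral_cong) (auto simp: norm_g)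
    then show ?thesis by (simp add: int_g int_eq)
  qed
  have "integrable (lebesgue_on {a..b}) (\<lambda>q. (H2_norm (\<lambda>s. E s q))\<^sup>2)
      \<longleftrightarrow> integrable (lebesgue_on {a..b}) (\<lambda>q. Re (g q))"
    by (intro Bochner_Integration.integrable_cong) (auto simp: norm_g)
  moreover have "AE q in lebesgue_on {a..b}. (\<lambda>s. E s q) \<in> hardy_H2"
    by (intro AE_I2) (simp add: hardy)
  ultimately have "E \<in> H2_L2 a b"
    using int_g by (simp add: H2_L2_def)
  then show "H2_L2_norm a b E = ennreal (sqrt (Re (energy a b za zb M)))"
    by (simp add: H2_L2_norm_def sq)
  have "0 \<le> (\<integral>q. (H2_norm (\<lambda>s. E s q))\<^sup>2 \<partial>lebesgue_on {a..b})"
    by simp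
  then show "Re (energy a b za zb M) \<ge> 0" by (simp add: sq)
qed

text \<open>The energy is a Hermitian form, hence its derivative along a motion of residues and poles is the
  contribution of the first factor plus its conjugate. This is the contribution of the first factor,
  when the residues move with velocity \<open>M'\<close> and the end values of the poles with \<open>ha\<close> and \<open>hb\<close>.\<close>

definition half_variation ::
    "real \<Rightarrow> real \<Rightarrow> ('k::finite \<Rightarrow> complex) \<Rightarrow> ('k \<Rightarrow> complex) \<Rightarrow> ('k \<Rightarrow> complex^'m^'p) \<Rightarrow>
     ('k \<Rightarrow> complex) \<Rightarrow> ('k \<Rightarrow> complex) \<Rightarrow> ('k \<Rightarrow> complex^'m^'p) \<Rightarrow> complex" where
  "half_variation a b za zb M ha hb M' =
     (\<Sum>k\<in>UNIV. \<Sum>l\<in>UNIV. frob (M' k) (M l) * pairing a b za zb k l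
        + frob (M k) (M l) * pairing_deriv a b za zb k l (ha k) (hb k))"

lemma frob_has_vector_derivative:
  fixes M N :: "real \<Rightarrow> complex^'m^'p"
  assumes "\<And>i j. ((\<lambda>t. M t $ i $ j) has_vector_derivative M' $ i $ j) (at t0)"
    and "\<And>i j. ((\<lambda>t. N t $ i $ j) has_vector_derivative N' $ i $ j) (at t0)"
  shows "((\<lambda>t. frob (M t) (N t)) has_vector_derivative frob M' (N t0) + frob (M t0) N') (at t0)"
proof -
  have "((\<lambda>t. frob (M t) (N t)) has_vector_derivative
     (\<Sum>i\<in>UNIV. \<Sum>j\<in>UNIV. M t0 $ i $ j * cnj (N' $ i $ j) + M' $ i $ j * cnj (N t0 $ i $ j))) (at t0)"
    unfolding frob_def
    by (intro has_vector_derivative_sum has_vector_derivative_mult has_vector_derivative_cnj assms)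
  then show ?thesis by (simp add: frob_def sum.distrib add.commute)
qed

text \<open>The product rule yields the terms from the first factor and those from the second; exchanging
  the two summation indices shows that the latter are conjugate to the former.\<close>

lemma energy_has_vector_derivative:
  fixes M :: "real \<Rightarrow> 'k::finite \<Rightarrow> complex^'m^'p"
    and ha hb :: "'k \<Rightarrow> complex"
  assumes ab: "a < b"
    and za: "\<And>k. Re (za k) < 0" and zb: "\<And>k. Re (zb k) < 0"
    and M: "\<And>k i j. ((\<lambda>t. M t k $ i $ j) has_vector_derivative M' k $ i $ j) (at 0)"
  defines "D \<equiv> half_variation a b za zb (M 0) ha hb M'"
  shows "((\<lambda>t. energy a b (\<lambda>k. za k + of_real t * ha k) (\<lambda>k. zb k + of_real t * hb k) (M t))
    has_vector_derivative D + cnj D) (at 0)"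
proof -
  let ?P = "pairing a b za zb"
  let ?P' = "pairing_deriv a b za zb"
  have pos: "Re (- (za k + cnj (za l))) > 0" "Re (- (zb k + cnj (zb l))) > 0" for k l
    using za[of k] za[of l] zb[of k] zb[of l] by auto
  have P': "((\<lambda>t. pairing a b (\<lambda>k. za k + of_real t * ha k) (\<lambda>k. zb k + of_real t * hb k) k l)
     has_vector_derivative ?P' k l (ha k) (hb k) + ?P' k l (cnj (ha l)) (cnj (hb l))) (at 0)" for k l
  proof -
    have "((\<lambda>t. line_kernel a b (- (za k + cnj (za l)) + of_real t * (- ha k + - cnj (ha l)))
        (- (zb k + cnj (zb l)) + of_real t * (- hb k + - cnj (hb l)))) has_vector_derivative
      line_kernel_deriv a b (- (za k + cnj (za l))) (- (zb k + cnj (zb l)))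
        (- ha k + - cnj (ha l)) (- hb k + - cnj (hb l))) (at 0)"
      using has_vector_derivative_real_field[of _ _ 0, unfolded of_real_0,
          OF line_kernel_has_field_derivative[OF ab pos]] .
    then show ?thesis
      unfolding line_kernel_deriv_add[OF ab pos] pairing_def pairing_deriv_def
      by (simp add: algebra_simps)
  qed
  have "((\<lambda>t. energy a b (\<lambda>k. za k + of_real t * ha k) (\<lambda>k. zb k + of_real t * hb k) (M t))
    has_vector_derivative
     (\<Sum>k\<in>UNIV. \<Sum>l\<in>UNIV. frob (M 0 k) (M 0 l) * (?P' k l (ha k) (hb k) + ?P' k l (cnj (ha l)) (cnj (hb l)))
       + (frob (M' k) (M 0 l) + frob (M 0 k) (M' l)) * ?P k l)) (at 0)"
    unfolding energy_def
    using has_vector_derivative_mult[OF frob_has_vector_derivative[OF M M] P']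
    by (intro has_vector_derivative_sum) simp
  also have "(\<Sum>k\<in>UNIV. \<Sum>l\<in>UNIV. frob (M 0 k) (M 0 l) * (?P' k l (ha k) (hb k) + ?P' k l (cnj (ha l)) (cnj (hb l)))
       + (frob (M' k) (M 0 l) + frob (M 0 k) (M' l)) * ?P k l)
     = D + (\<Sum>k\<in>UNIV. \<Sum>l\<in>UNIV. frob (M 0 k) (M' l) * ?P k l
        + frob (M 0 k) (M 0 l) * ?P' k l (cnj (ha l)) (cnj (hb l)))"
    unfolding D_def half_variation_def sum.distrib[symmetric]
    by (intro sum.cong refl) (simp add: algebra_simps)
  \<comment> \<open>Hermitian symmetry: the second factor contributes the conjugate.\<close>
  also have "(\<Sum>k\<in>UNIV. \<Sum>l\<in>UNIV. frob (M 0 k) (M' l) * ?P k l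
        + frob (M 0 k) (M 0 l) * ?P' k l (cnj (ha l)) (cnj (hb l))) = cnj D"
    unfolding D_def half_variation_def
    by (subst sum.swap) (simp add: cnj_pairing cnj_pairing_deriv frob_cnj)
  finally show ?thesis .
qed

lemma half_variation_eq_0_at_local_min:
  fixes M :: "real \<Rightarrow> 'k::finite \<Rightarrow> complex^'m^'p"
  assumes "a < b"
    and "\<And>k. Re (za k) < 0" and "\<And>k. Re (zb k) < 0"
    and "\<And>k i j. ((\<lambda>t. M t k $ i $ j) has_vector_derivative M' k $ i $ j) (at 0)"
    and min: "\<forall>\<^sub>F t in nhds 0. Re (energy a b za zb (M 0)) \<le>
       Re (energy a b (\<lambda>k. za k + of_real t * ha k) (\<lambda>k. zb k + of_real t * hb k) (M t))"
  shows "Re (half_variation a b za zb (M 0) ha hb M') = 0"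
proof -
  let ?D = "half_variation a b za zb (M 0) ha hb M'"
  let ?J = "\<lambda>t. Re (energy a b (\<lambda>k. za k + of_real t * ha k) (\<lambda>k. zb k + of_real t * hb k) (M t))"
  have "(?J has_real_derivative Re (?D + cnj ?D)) (at 0)"
    unfolding has_real_derivative_iff_has_vector_derivative
    by (rule bounded_linear.has_vector_derivative[OF bounded_linear_Re
        energy_has_vector_derivative[OF assms(1-4)]])
  moreover obtain d where "d > 0" "\<And>t. \<bar>t\<bar> < d \<Longrightarrow> Re (energy a b za zb (M 0)) \<le> ?J t"
    using min unfolding eventually_nhds_metric by (auto simp: dist_norm)
  ultimately have "Re (?D + cnj ?D) = 0"
    by (intro DERIV_local_min[of ?J _ 0 d]) auto
  then show ?thesis by simp
qed

section \<open>The error of a diagonal model\<close>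

text \<open>The error of a reduced model is the difference of two transfer functions and is treated as one
  pole-residue function: the poles of both models are indexed by the sum type, and the reduced
  model enters with negated residues.\<close>

definition error_pole ::
    "complex^'n \<Rightarrow> complex^'n \<Rightarrow> complex^'r \<Rightarrow> complex^'r \<Rightarrow> real \<Rightarrow> 'n + 'r \<Rightarrow> complex" where
  "error_pole \<nu>1 \<nu>2 p1 p2 q =
     case_sum (\<lambda>i. \<nu>1 $ i + of_real q * \<nu>2 $ i) (\<lambda>i. p1 $ i + of_real q * p2 $ i)"

definition error_residue ::
    "complex^'m^'n \<Rightarrow> complex^'n^'p \<Rightarrow> complex^'m^'r \<Rightarrow> complex^'r^'p \<Rightarrow> 'n + 'r \<Rightarrow> complex^'m^'p" where
  "error_residue B C Bh Ch =
     case_sum (\<lambda>i. outer (column i C) (row i B)) (\<lambda>i. - outer (column i Ch) (row i Bh))"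

lemma sum_UNIV_Plus:
  fixes f :: "'n::finite + 'r::finite \<Rightarrow> 'a::comm_monoid_add"
  shows "(\<Sum>l\<in>UNIV. f l) = (\<Sum>i\<in>UNIV. f (Inl i)) + (\<Sum>i\<in>UNIV. f (Inr i))"
  by (simp add: UNIV_Plus_UNIV[symmetric] sum.Plus del: UNIV_Plus_UNIV)

lemma cscale_minus: "cscale z (- M) = - cscale z M"
  by (simp add: cscale_def map_matrix_def vec_eq_iff)

lemma error_pole_eq_chord:
  assumes "a < b"
  shows "error_pole \<nu>1 \<nu>2 p1 p2 q k =
    chord a b (error_pole \<nu>1 \<nu>2 p1 p2 a k) (error_pole \<nu>1 \<nu>2 p1 p2 b k) q"
  unfolding error_pole_def by (cases k) (simp_all add: affine_eq_chord[OF assms, symmetric])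

lemma H2_L2_error_eq_energy:
  fixes \<nu>1 \<nu>2 :: "complex^'n" and p1 p2 :: "complex^'r"
    and B :: "complex^'m^'n" and C :: "complex^'n^'p"
  assumes ab: "a < b"
    and za: "\<And>k. Re (error_pole \<nu>1 \<nu>2 p1 p2 a k) < 0"
    and zb: "\<And>k. Re (error_pole \<nu>1 \<nu>2 p1 p2 b k) < 0"
  shows "H2_L2_error a b (affine_tf (diag_of \<nu>1) (diag_of \<nu>2) B C) (diag_of p1) (diag_of p2) Bh Ch =
     ennreal (sqrt (Re (energy a b (error_pole \<nu>1 \<nu>2 p1 p2 a) (error_pole \<nu>1 \<nu>2 p1 p2 b)
        (error_residue B C Bh Ch))))" (is ?eq)
    and "Re (energy a b (error_pole \<nu>1 \<nu>2 p1 p2 a) (error_pole \<nu>1 \<nu>2 p1 p2 b)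
        (error_residue B C Bh Ch)) \<ge> 0" (is ?nonneg)
proof -
  have E: "affine_tf (diag_of \<nu>1) (diag_of \<nu>2) B C s q - affine_tf (diag_of p1) (diag_of p2) Bh Ch s q
      = pole_residue (\<lambda>k. chord a b (error_pole \<nu>1 \<nu>2 p1 p2 a k) (error_pole \<nu>1 \<nu>2 p1 p2 b k) q)
          (error_residue B C Bh Ch) s"
    if s: "Re s > 0" and q: "q \<in> {a..b}" for s q
  proof -
    have "Re (error_pole \<nu>1 \<nu>2 p1 p2 q k) < 0" for k
      using Re_chord_pos[OF ab q, of "- error_pole \<nu>1 \<nu>2 p1 p2 a k" "- error_pole \<nu>1 \<nu>2 p1 p2 b k"]
        chord_scale[of a b "-1" "error_pole \<nu>1 \<nu>2 p1 p2 a k" "error_pole \<nu>1 \<nu>2 p1 p2 b k" q]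
        za[of k] zb[of k]
      by (simp add: error_pole_eq_chord[OF ab, of \<nu>1 \<nu>2 p1 p2 q k])
    then have ne: "s \<noteq> error_pole \<nu>1 \<nu>2 p1 p2 q k" for k
      using s by (metis less_asym)
    have 1: "s \<noteq> \<nu>1 $ i + of_real q * \<nu>2 $ i" for i
      using ne[of "Inl i"] by (simp add: error_pole_def)
    have 2: "s \<noteq> p1 $ i + of_real q * p2 $ i" for i
      using ne[of "Inr i"] by (simp add: error_pole_def)
    show ?thesis
      unfolding affine_tf_diag[OF 1] affine_tf_diag[OF 2] error_pole_eq_chord[OF ab, symmetric]
        pole_residue_def sum_UNIV_Plus
      by (simp add: error_pole_def error_residue_def cscale_minus sum_negf)
  qed
  show ?eq unfolding H2_L2_error_def by (rule H2_L2_norm_eq_energy(1)[OF ab za zb E])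
  show ?nonneg by (rule H2_L2_norm_eq_energy(2)[OF ab za zb E])
qed

section \<open>Stationarity and interpolation at an optimal model\<close>

lemma diag_of_line: "diag_of (u + t *\<^sub>R v) = diag_of u + t *\<^sub>R diag_of v"
  by (simp add: diag_of_def vec_eq_iff)

lemma is_diagonal_diag_of: "is_diagonal (diag_of v)"
  by (simp add: is_diagonal_def diag_of_def)

text \<open>On a straight line of diagonal models through the optimum, the models near it stay within the range
  of the local minimality and keep their poles at \<open>a\<close> and \<open>b\<close>, hence on all of \<open>[a, b]\<close>, in the left
  half-plane. So the energy has a local minimum there.\<close>

lemma optimal_half_variation_eq_0:
  fixes a b :: real and \<nu>1 \<nu>2 :: "complex^'n" and lam1 lam2 d1 d2 :: "complex^'r"
    and B :: "complex^'m^'n" and C :: "complex^'n^'p"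
    and Bh dB :: "complex^'m^'r" and Ch dC :: "complex^'r^'p"
  defines "za \<equiv> error_pole \<nu>1 \<nu>2 lam1 lam2 a" and "zb \<equiv> error_pole \<nu>1 \<nu>2 lam1 lam2 b"
  assumes ab: "a < b"
    and za: "\<And>k. Re (za k) < 0" and zb: "\<And>k. Re (zb k) < 0"
    and opt: "optimal_D_StROM a b (affine_tf (diag_of \<nu>1) (diag_of \<nu>2) B C)
      (diag_of lam1) (diag_of lam2) Bh Ch"
  shows "Re (half_variation a b za zb (error_residue B C Bh Ch)
     (error_pole 0 0 d1 d2 a) (error_pole 0 0 d1 d2 b)
     (case_sum (\<lambda>_. 0) (\<lambda>i. - (outer (column i dC) (row i Bh) + outer (column i Ch) (row i dB))))) = 0"
proof -
  let ?H = "affine_tf (diag_of \<nu>1) (diag_of \<nu>2) B C"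
  define X where "X = (\<lambda>t. (diag_of lam1 + t *\<^sub>R diag_of d1, diag_of lam2 + t *\<^sub>R diag_of d2,
    Bh + t *\<^sub>R dB, Ch + t *\<^sub>R dC))"
  define M where "M = (\<lambda>t. error_residue B C (Bh + t *\<^sub>R dB) (Ch + t *\<^sub>R dC))"
  define za' where "za' = (\<lambda>t k. za k + of_real t * error_pole 0 0 d1 d2 a k)"
  define zb' where "zb' = (\<lambda>t k. zb k + of_real t * error_pole 0 0 d1 d2 b k)"
  obtain \<epsilon> where \<epsilon>: "\<epsilon> > 0" and best: "\<And>A1' A2' B' C'. is_diagonal A1' \<Longrightarrow> is_diagonal A2' \<Longrightarrow>
        dist (A1', A2', B', C') (diag_of lam1, diag_of lam2, Bh, Ch) < \<epsilon> \<Longrightarrow>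
        H2_L2_error a b ?H (diag_of lam1) (diag_of lam2) Bh Ch \<le> H2_L2_error a b ?H A1' A2' B' C'"
    using opt unfolding optimal_D_StROM_def by blast
  have line: "((\<lambda>t. u + t *\<^sub>R v) \<longlongrightarrow> u) (nhds (0::real))" for u v :: "'z::real_normed_vector"
  proof -
    have "((\<lambda>t::real. u + t *\<^sub>R v) \<longlongrightarrow> u + 0 *\<^sub>R v) (nhds 0)"
      by (intro tendsto_intros filterlim_ident)
    then show ?thesis by simp
  qed
  have "(X \<longlongrightarrow> (diag_of lam1, diag_of lam2, Bh, Ch)) (nhds 0)"
    unfolding X_def by (intro tendsto_Pair line)
  then have near: "\<forall>\<^sub>F t in nhds 0. dist (X t) (diag_of lam1, diag_of lam2, Bh, Ch) < \<epsilon>"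
    using \<epsilon> by (rule tendstoD)
  have stays_stable: "\<forall>\<^sub>F t in nhds 0. \<forall>k. Re (z k + of_real t * h k) < 0"
    if "\<And>k. Re (z k) < 0" for z h :: "'n + 'r \<Rightarrow> complex"
  proof (intro eventually_all_finite allI)
    fix k
    have "((\<lambda>t. Re (z k + t *\<^sub>R h k)) \<longlongrightarrow> Re (z k)) (nhds (0::real))"
      by (intro tendsto_Re line)
    from order_tendstoD(2)[OF this that[of k]]
    show "\<forall>\<^sub>F t in nhds 0. Re (z k + of_real t * h k) < 0"
      by (simp add: scaleR_conv_of_real)
  qed
  have poles: "error_pole \<nu>1 \<nu>2 (lam1 + t *\<^sub>R d1) (lam2 + t *\<^sub>R d2) a = za' t"
    "error_pole \<nu>1 \<nu>2 (lam1 + t *\<^sub>R d1) (lam2 + t *\<^sub>R d2) b = zb' t" for t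
    by (auto simp: fun_eq_iff za'_def zb'_def za_def zb_def error_pole_def
        scaleR_conv_of_real[where 'a = complex] algebra_simps split: sum.split)
  have M0: "M 0 = error_residue B C Bh Ch" by (simp add: M_def)
  have stable_a: "\<forall>\<^sub>F t in nhds 0. \<forall>k. Re (za' t k) < 0"
    and stable_b: "\<forall>\<^sub>F t in nhds 0. \<forall>k. Re (zb' t k) < 0"
    unfolding za'_def zb'_def by (rule stays_stable, rule za, rule stays_stable, rule zb)
  have "\<forall>\<^sub>F t in nhds 0. Re (energy a b za zb (M 0)) \<le> Re (energy a b (za' t) (zb' t) (M t))"
    using near stable_a stable_b
  proof eventually_elim
    case (elim t)
    have st: "Re (error_pole \<nu>1 \<nu>2 (lam1 + t *\<^sub>R d1) (lam2 + t *\<^sub>R d2) a k) < 0"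
      "Re (error_pole \<nu>1 \<nu>2 (lam1 + t *\<^sub>R d1) (lam2 + t *\<^sub>R d2) b k) < 0" for k
      unfolding poles using elim(2,3) by blast+
    have "H2_L2_error a b ?H (diag_of lam1) (diag_of lam2) Bh Ch \<le>
        H2_L2_error a b ?H (diag_of (lam1 + t *\<^sub>R d1)) (diag_of (lam2 + t *\<^sub>R d2))
          (Bh + t *\<^sub>R dB) (Ch + t *\<^sub>R dC)"
      using elim(1) unfolding X_def diag_of_line[symmetric]
      by (intro best is_diagonal_diag_of)
    moreover have "H2_L2_error a b ?H (diag_of lam1) (diag_of lam2) Bh Ch
        = ennreal (sqrt (Re (energy a b za zb (M 0))))"
      unfolding M0 za_def zb_def
      by (rule H2_L2_error_eq_energy(1)[OF ab za[unfolded za_def] zb[unfolded zb_def]])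
    moreover have "H2_L2_error a b ?H (diag_of (lam1 + t *\<^sub>R d1)) (diag_of (lam2 + t *\<^sub>R d2))
          (Bh + t *\<^sub>R dB) (Ch + t *\<^sub>R dC) = ennreal (sqrt (Re (energy a b (za' t) (zb' t) (M t))))"
      unfolding M_def poles[symmetric] by (rule H2_L2_error_eq_energy(1)[OF ab st])
    moreover have "Re (energy a b (za' t) (zb' t) (M t)) \<ge> 0"
      using H2_L2_error_eq_energy(2)[OF ab st, of B C] unfolding poles M_def .
    ultimately show ?case by (simp add: ennreal_le_iff)
  qed
  moreover have "((\<lambda>t. M t k $ i $ j) has_vector_derivative
     (case_sum (\<lambda>_. 0) (\<lambda>i. - (outer (column i dC) (row i Bh) + outer (column i Ch) (row i dB))) k) $ i $ j)
     (at 0)" for k i j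
  proof (cases k)
    case (Inl n)
    then show ?thesis by (simp add: M_def error_residue_def)
  next
    case (Inr r)
    have 1: "((\<lambda>t. x + t *\<^sub>R y) has_vector_derivative y) (at 0)" for x y :: complex
      unfolding has_vector_derivative_def by (auto intro!: derivative_eq_intros)
    have "((\<lambda>t. - ((x + t *\<^sub>R y) * (z + t *\<^sub>R w))) has_vector_derivative - (x * w + y * z)) (at 0)"
      for x y z w :: complex
      using has_vector_derivative_minus[OF has_vector_derivative_mult[OF 1[of x y] 1[of z w]]] by simp
    from this[of "Ch $ i $ r" "dC $ i $ r" "Bh $ r $ j" "dB $ r $ j"] show ?thesis
      using Inr by (simp add: M_def error_residue_def outer_def column_def row_def add.commute)
  qed
  ultimately show ?thesis
    unfolding za'_def zb'_def M0[symmetric]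
    by (intro half_variation_eq_0_at_local_min[OF ab za zb])
qed

text \<open>If only one pole and its residue move, reflecting that pole at the imaginary axis turns the
  pairings into conjugates of kernel values. The sums over \<open>l\<close> become the values and a directional
  derivative, at the reflected pole, of the kernel sum with the residues \<open>M\<close>.\<close>

lemma half_variation_single:
  fixes za zb :: "'k::finite \<Rightarrow> complex"
  assumes "\<And>k. k \<noteq> k0 \<Longrightarrow> M' k = 0 \<and> ha k = 0 \<and> hb k = 0"
  defines "sa \<equiv> - cnj (za k0)" and "sb \<equiv> - cnj (zb k0)"
  shows "half_variation a b za zb M ha hb M' =
    frob (M' k0) (\<Sum>l\<in>UNIV. cscale (line_kernel a b (sa - za l) (sb - zb l)) (M l)) +
    frob (M k0) (\<Sum>l\<in>UNIV. cscale
      (line_kernel_deriv a b (sa - za l) (sb - zb l) (- cnj (ha k0)) (- cnj (hb k0))) (M l))"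
proof -
  let ?T = "\<lambda>k. \<Sum>l\<in>UNIV. frob (M' k) (M l) * pairing a b za zb k l
        + frob (M k) (M l) * pairing_deriv a b za zb k l (ha k) (hb k)"
  have "?T k = 0" if "k \<noteq> k0" for k
    using assms(1)[OF that]
    by (simp add: frob_def pairing_deriv_def line_kernel_deriv_def chord_def)
  then have "half_variation a b za zb M ha hb M' = ?T k0"
    unfolding half_variation_def by (subst sum.remove[of _ k0]) (auto intro!: sum.neutral)
  moreover have "pairing a b za zb k0 l = cnj (line_kernel a b (sa - za l) (sb - zb l))" for l
    by (simp add: pairing_def sa_def sb_def flip: line_kernel_cnj)
  moreover have "pairing_deriv a b za zb k0 l (ha k0) (hb k0) =
     cnj (line_kernel_deriv a b (sa - za l) (sb - zb l) (- cnj (ha k0)) (- cnj (hb k0)))" for l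
    by (simp add: pairing_deriv_def sa_def sb_def flip: line_kernel_deriv_cnj)
  ultimately show ?thesis
    by (simp add: frob_sum_right frob_cscale_right sum.distrib mult.commute)
qed

text \<open>The two ways of reading a pairing with a rank-one matrix lead to the right and to the left
  tangential conditions.\<close>

lemma frob_outer_mult_vec: "frob N (outer c r) = conj_dot c (N *v conj_vec r)"
  by (simp add: frob_def outer_def conj_dot_def conj_vec_def matrix_vector_mult_def
      sum_distrib_left mult_ac)

lemma frob_outer_vec_mult: "frob N (outer c r) = conj_dot r (conj_vec c v* N)"
proof -
  have "frob N (outer c r) = (\<Sum>j\<in>UNIV. \<Sum>i\<in>UNIV. N $ i $ j * cnj (c $ i * r $ j))"
    unfolding frob_def outer_def by (simp add: sum.swap[of "\<lambda>i j. N $ i $ j * (cnj (c $ i) * cnj (r $ j))"])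
  then show ?thesis
    by (simp add: conj_dot_def conj_vec_def vector_matrix_mult_def sum_distrib_left mult_ac)
qed

lemma conj_dot_self_eq_0D:
  assumes "Re (conj_dot v v) = 0"
  shows "v = 0"
proof -
  have "conj_dot v v = complex_of_real (\<Sum>k\<in>UNIV. (norm (v $ k))\<^sup>2)"
    by (simp add: conj_dot_def complex_norm_square mult.commute del: of_real_power)
  with assms have "(\<Sum>k\<in>UNIV. (norm (v $ k))\<^sup>2) = 0" by simp
  then have "\<forall>k\<in>UNIV. (norm (v $ k))\<^sup>2 = 0"
    by (subst (asm) sum_nonneg_eq_0_iff) auto
  then show ?thesis by (simp add: vec_eq_iff)
qed

text \<open>Moving the residue and the pole of one summand gives a real-linear condition in the velocities
  \<open>w\<close>, \<open>r\<close> and \<open>(h, k)\<close>. These are independent of each other and may be arbitrary complex, so each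
  part of the condition vanishes by itself: a velocity made from the quantity in question turns the
  condition into the vanishing of its squared norm.\<close>

lemma optimal_interpolation:
  fixes a b :: real and \<nu>1 \<nu>2 :: "complex^'n" and lam1 lam2 :: "complex^'r"
    and B :: "complex^'m^'n" and C :: "complex^'n^'p"
    and Bh :: "complex^'m^'r" and Ch :: "complex^'r^'p"
  defines "za \<equiv> error_pole \<nu>1 \<nu>2 lam1 lam2 a" and "zb \<equiv> error_pole \<nu>1 \<nu>2 lam1 lam2 b"
    and "M \<equiv> error_residue B C Bh Ch"
  assumes ab: "a < b"
    and za: "\<And>k. Re (za k) < 0" and zb: "\<And>k. Re (zb k) < 0"
    and opt: "optimal_D_StROM a b (affine_tf (diag_of \<nu>1) (diag_of \<nu>2) B C)
      (diag_of lam1) (diag_of lam2) Bh Ch"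
  defines "c \<equiv> \<lambda>i. column i Ch" and "d \<equiv> \<lambda>i. conj_vec (row i Bh)"
    and "sa \<equiv> \<lambda>i. - cnj (za (Inr i))" and "sb \<equiv> \<lambda>i. - cnj (zb (Inr i))"
  defines "N \<equiv> \<lambda>i. \<Sum>l\<in>UNIV. cscale (line_kernel a b (sa i - za l) (sb i - zb l)) (M l)"
    and "N' \<equiv> \<lambda>i h k. \<Sum>l\<in>UNIV. cscale (line_kernel_deriv a b (sa i - za l) (sb i - zb l) h k) (M l)"
  shows "N i *v d i = 0" and "conj_vec (c i) v* N i = 0"
    and "conj_dot (c i) (N' i 1 0 *v d i) = 0" and "conj_dot (c i) (N' i 0 1 *v d i) = 0"
proof -
  have stationary: "Re (frob (outer w (row i Bh)) (N i) + frob (outer (c i) r) (N i)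
      + frob (outer (c i) (row i Bh)) (N' i h k)) = 0" for w r h k
  proof -
    \<comment> \<open>The pole moves by \<open>d1 + q d2\<close>, which is \<open>- cnj h\<close> at \<open>a\<close> and \<open>- cnj k\<close> at \<open>b\<close>; the reflection
      of the pole turns these into \<open>h\<close> and \<open>k\<close>.\<close>
    define d2 where "d2 = (- cnj k + cnj h) / of_real (b - a)"
    define d1 where "d1 = - cnj h - of_real a * d2"
    define \<delta>1 where "\<delta>1 = (\<chi> j. if j = i then d1 else 0)"
    define \<delta>2 where "\<delta>2 = (\<chi> j. if j = i then d2 else 0)"
    define dC where "dC = (\<chi> l j. if j = i then w $ l else 0)"
    define dB where "dB = (\<chi> j. if j = i then r else 0)"
    have "of_real (b - a) * d2 = - cnj k + cnj h"
      using ab unfolding d2_def by (simp del: of_real_diff)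
    then have ends: "d1 + of_real a * d2 = - cnj h" "d1 + of_real b * d2 = - cnj k"
      by (auto simp: d1_def algebra_simps)
    have "half_variation a b za zb M (error_pole 0 0 \<delta>1 \<delta>2 a) (error_pole 0 0 \<delta>1 \<delta>2 b)
     (case_sum (\<lambda>_. 0) (\<lambda>i. - (outer (column i dC) (row i Bh) + outer (column i Ch) (row i dB))))
     = frob (- (outer w (row i Bh) + outer (c i) r)) (N i)
      + frob (- outer (c i) (row i Bh)) (N' i h k)"
      unfolding N_def N'_def sa_def sb_def
    proof (subst half_variation_single[where ?k0.0 = "Inr i"])
      fix j :: "'n + 'r" assume "j \<noteq> Inr i"
      then show "case_sum (\<lambda>_. 0) (\<lambda>i. - (outer (column i dC) (row i Bh) + outer (column i Ch) (row i dB))) j = 0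
          \<and> error_pole 0 0 \<delta>1 \<delta>2 a j = 0 \<and> error_pole 0 0 \<delta>1 \<delta>2 b j = 0"
        by (cases j) (auto simp: error_pole_def \<delta>1_def \<delta>2_def dC_def dB_def column_def row_def
            outer_def vec_eq_iff)
    qed (simp add: error_pole_def \<delta>1_def \<delta>2_def ends M_def error_residue_def c_def dC_def dB_def
          column_def row_def vec_lambda_eta)
    moreover have "Re (half_variation a b za zb M (error_pole 0 0 \<delta>1 \<delta>2 a) (error_pole 0 0 \<delta>1 \<delta>2 b)
     (case_sum (\<lambda>_. 0) (\<lambda>i. - (outer (column i dC) (row i Bh) + outer (column i Ch) (row i dB))))) = 0"
      using optimal_half_variation_eq_0[OF ab _ _ opt] za zb
      unfolding za_def zb_def M_def by blast
    moreover have "frob (- X) Y = - frob X Y" "frob (X - Z) Y = frob X Y - frob Z Y"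
      for X Y Z :: "complex^'m^'p"
      by (simp_all add: frob_def sum_negf sum_subtractf left_diff_distrib)
    ultimately show ?thesis by simp
  qed
  have outer_0: "outer 0 r = 0" "outer w 0 = 0" for r :: "complex^'m" and w :: "complex^'p"
    by (simp_all add: outer_def vec_eq_iff)
  have frob_0: "frob 0 Y = 0" "frob Y 0 = 0" for Y :: "complex^'m^'p"
    by (simp_all add: frob_def)
  have Re_frob: "Re (frob X Y) = Re (frob Y X)" for X Y :: "complex^'m^'p"
    by (metis frob_cnj complex_cnj(1) cnj.sel(1))
  have lin: "N' i (z * h) (z * k) = cscale z (N' i h k)" for z h k
    unfolding N'_def line_kernel_deriv_scale
    by (simp add: cscale_def map_matrix_def vec_eq_iff sum_distrib_left mult.assoc)
  have N'0: "N' i 0 0 = 0"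
    using lin[of 0 0 0] by (simp add: cscale_def map_matrix_def vec_eq_iff)
  show "N i *v d i = 0"
  proof (rule conj_dot_self_eq_0D)
    show "Re (conj_dot (N i *v d i) (N i *v d i)) = 0"
      \<comment> \<open>The residual itself is the velocity of the column of \<open>Ch\<close>.\<close>
      using stationary[of "N i *v d i" 0 0 0]
      by (simp add: outer_0 frob_0 N'0 Re_frob[of _ "N i"] frob_outer_mult_vec d_def)
  qed
  show "conj_vec (c i) v* N i = 0"
  proof (rule conj_dot_self_eq_0D)
    show "Re (conj_dot (conj_vec (c i) v* N i) (conj_vec (c i) v* N i)) = 0"
      \<comment> \<open>The residual itself is the velocity of the row of \<open>Bh\<close>.\<close>
      using stationary[of 0 "conj_vec (c i) v* N i" 0 0]
      by (simp add: outer_0 frob_0 N'0 Re_frob[of _ "N i"] frob_outer_vec_mult)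
  qed
  have "conj_dot (c i) (N' i h k *v d i) = 0" for h k
  proof -
    define x where "x = frob (N' i h k) (outer (c i) (row i Bh))"
    \<comment> \<open>Multiplying the direction \<open>(h, k)\<close> by \<open>cnj x\<close> turns the real part into the squared modulus of \<open>x\<close>.\<close>
    have "Re (frob (outer (c i) (row i Bh)) (cscale (cnj x) (N' i h k))) = 0"
      using stationary[of 0 0 "cnj x * h" "cnj x * k"] by (simp add: outer_0 frob_0 lin)
    then have "Re (complex_of_real ((norm x)\<^sup>2)) = 0"
      unfolding frob_cscale_right complex_norm_square x_def by (simp only: frob_cnj complex_cnj_cnj)
    then show ?thesis by (simp add: x_def frob_outer_mult_vec d_def)
  qed
  then show "conj_dot (c i) (N' i 1 0 *v d i) = 0" "conj_dot (c i) (N' i 0 1 *v d i) = 0"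
    by blast+
qed

lemma matrix_deriv_sum_cscale:
  assumes "\<And>l. (f l has_field_derivative f' l) (at z)"
  shows "matrix_deriv (\<lambda>s. \<Sum>l\<in>UNIV. cscale (f l s) (M l)) z = (\<Sum>l\<in>UNIV. cscale (f' l) (M l))"
proof -
  have "((\<lambda>s. \<Sum>l\<in>UNIV. f l s * M l $ i $ j) has_field_derivative (\<Sum>l\<in>UNIV. f' l * M l $ i $ j)) (at z)" for i j
    by (intro DERIV_sum DERIV_cmult_right assms)
  then show ?thesis
    by (simp add: matrix_deriv_def vec_eq_iff cscale_def map_matrix_def DERIV_imp_deriv)
qed

theorem theorem5p1:
  fixes a b :: real
    and \<nu>1 \<nu>2 :: "complex^'n" and B :: "complex^'m^'n" and C :: "complex^'n^'p"
    and lam1 lam2 :: "complex^'r" and Bh :: "complex^'m^'r" and Ch :: "complex^'r^'p"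
  defines "\<nu> \<equiv> \<lambda>i q. \<nu>1 $ i + complex_of_real q * \<nu>2 $ i"
    and "lam \<equiv> \<lambda>i q. lam1 $ i + complex_of_real q * lam2 $ i"
    and "\<Phi> \<equiv> \<lambda>i. outer (column i C) (row i B)"
    and "c \<equiv> \<lambda>i. column i Ch"
    and "d \<equiv> \<lambda>i. column i (conj_transpose Bh)"
    and "H \<equiv> affine_tf (diag_of \<nu>1) (diag_of \<nu>2) B C"
  defines "G \<equiv> \<lambda>sa sb. \<Sum>i\<in>UNIV. cscale (f_kernel a b (\<nu> i a) (\<nu> i b) sa sb) (\<Phi> i)"
    and "Gh \<equiv> \<lambda>sa sb. \<Sum>i\<in>UNIV. cscale (f_kernel a b (lam i a) (lam i b) sa sb)
                                     (outer (c i) (conj_vec (d i)))"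
  assumes "a < b"
    and "\<And>i q. q \<in> {a..b} \<Longrightarrow> Re (\<nu> i q) < 0"
    and "\<And>i q. q \<in> {a..b} \<Longrightarrow> Re (lam i q) < 0"
    and "optimal_D_StROM a b H (diag_of lam1) (diag_of lam2) Bh Ch"
  shows "\<forall>i. let sa = - cnj (lam i a); sb = - cnj (lam i b) in
      G sa sb *v d i = Gh sa sb *v d i \<and>
      conj_vec (c i) v* G sa sb = conj_vec (c i) v* Gh sa sb \<and>
      conj_dot (c i) (matrix_deriv (\<lambda>s. G s sb) sa *v d i) =
        conj_dot (c i) (matrix_deriv (\<lambda>s. Gh s sb) sa *v d i) \<and>
      conj_dot (c i) (matrix_deriv (\<lambda>s. G sa s) sb *v d i) =
        conj_dot (c i) (matrix_deriv (\<lambda>s. Gh sa s) sb *v d i)"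
proof (intro allI, unfold Let_def, intro conjI)
  fix i
  define sa where "sa = - cnj (lam i a)"
  define sb where "sb = - cnj (lam i b)"
  define za where "za = error_pole \<nu>1 \<nu>2 lam1 lam2 a"
  define zb where "zb = error_pole \<nu>1 \<nu>2 lam1 lam2 b"
  define M where "M = error_residue B C Bh Ch"
  have za_simps: "za (Inl j) = \<nu> j a" "zb (Inl j) = \<nu> j b" "za (Inr k) = lam k a" "zb (Inr k) = lam k b"
    for j k
    by (simp_all add: za_def zb_def error_pole_def \<nu>_def lam_def)
  have ends: "a \<in> {a..b}" "b \<in> {a..b}" using \<open>a < b\<close> by auto
  have z: "Re (za k) < 0" "Re (zb k) < 0" for k
    by (cases k; simp add: za_simps assms(10,11)[OF ends(1)] assms(10,11)[OF ends(2)])+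
  have pos: "Re (sa - za k) > 0" "Re (sb - zb k) > 0" for k
    using z[of k] z[of "Inr i"] by (auto simp: sa_def sb_def za_simps)
  have pos\<nu>: "Re (sa - \<nu> k a) > 0" "Re (sb - \<nu> k b) > 0" for k
    using pos[of "Inl k"] by (auto simp: za_simps)
  have pos_lam: "Re (sa - lam k a) > 0" "Re (sb - lam k b) > 0" for k
    using pos[of "Inr k"] by (auto simp: za_simps)
  have d: "d k = conj_vec (row k Bh)" "conj_vec (d k) = row k Bh" for k
    by (simp_all add: d_def conj_vec_def column_def row_def conj_transpose_def vec_eq_iff)
  have conj_conj: "conj_vec (conj_vec x) = x" for x :: "complex^'m"
    by (simp add: conj_vec_def vec_eq_iff)
  \<comment> \<open>Over the sum type, a kernel sum with the error residues is a full-model sum minus a reduced one.\<close>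
  have split: "(\<Sum>l\<in>UNIV. cscale (\<phi> (za l) (zb l)) (M l)) =
      (\<Sum>j\<in>UNIV. cscale (\<phi> (\<nu> j a) (\<nu> j b)) (\<Phi> j))
      - (\<Sum>k\<in>UNIV. cscale (\<phi> (lam k a) (lam k b)) (outer (c k) (conj_vec (d k))))" for \<phi>
    unfolding sum_UNIV_Plus za_simps
    by (simp add: M_def error_residue_def \<Phi>_def c_def d conj_conj cscale_minus sum_negf)
  have N: "(\<Sum>l\<in>UNIV. cscale (line_kernel a b (sa - za l) (sb - zb l)) (M l)) = G sa sb - Gh sa sb"
    unfolding split[of "\<lambda>x y. line_kernel a b (sa - x) (sb - y)"] G_def Gh_def
    using f_kernel_eq_line_kernel[OF \<open>a < b\<close> pos\<nu>] f_kernel_eq_line_kernel[OF \<open>a < b\<close> pos_lam]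
    by simp
  have Na: "(\<Sum>l\<in>UNIV. cscale (line_kernel_deriv a b (sa - za l) (sb - zb l) 1 0) (M l)) =
      matrix_deriv (\<lambda>s. G s sb) sa - matrix_deriv (\<lambda>s. Gh s sb) sa"
    unfolding split[of "\<lambda>x y. line_kernel_deriv a b (sa - x) (sb - y) 1 0"] G_def Gh_def
    by (simp only: matrix_deriv_sum_cscale[OF f_kernel_has_derivative_sa[OF \<open>a < b\<close> pos\<nu>]]
        matrix_deriv_sum_cscale[OF f_kernel_has_derivative_sa[OF \<open>a < b\<close> pos_lam]])
  have Nb: "(\<Sum>l\<in>UNIV. cscale (line_kernel_deriv a b (sa - za l) (sb - zb l) 0 1) (M l)) =
      matrix_deriv (\<lambda>s. G sa s) sb - matrix_deriv (\<lambda>s. Gh sa s) sb"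
    unfolding split[of "\<lambda>x y. line_kernel_deriv a b (sa - x) (sb - y) 0 1"] G_def Gh_def
    by (simp only: matrix_deriv_sum_cscale[OF f_kernel_has_derivative_sb[OF \<open>a < b\<close> pos\<nu>]]
        matrix_deriv_sum_cscale[OF f_kernel_has_derivative_sb[OF \<open>a < b\<close> pos_lam]])
  have conj_dot_diff: "conj_dot u (v - w) = conj_dot u v - conj_dot u w" for u v w :: "complex^'p"
    by (simp add: conj_dot_def right_diff_distrib sum_subtractf)
  have vec_diff: "u v* (X - Y) = u v* X - u v* Y" for u and X Y :: "complex^'m^'p"
    by (simp add: vector_matrix_mult_def vec_eq_iff right_diff_distrib sum_subtractf)
  note opt = optimal_interpolation[of a b \<nu>1 \<nu>2 lam1 lam2 B C Bh Ch i,
      folded za_def zb_def M_def H_def, OF \<open>a < b\<close> z assms(12),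
      unfolded za_simps, folded sa_def sb_def d(1), unfolded N Na Nb]
  have c: "column i Ch = c i" by (simp add: c_def)
  show "G (- cnj (lam i a)) (- cnj (lam i b)) *v d i = Gh (- cnj (lam i a)) (- cnj (lam i b)) *v d i"
    using opt(1) by (simp add: matrix_vector_mult_diff_rdistrib flip: sa_def sb_def)
  show "conj_vec (c i) v* G (- cnj (lam i a)) (- cnj (lam i b)) =
      conj_vec (c i) v* Gh (- cnj (lam i a)) (- cnj (lam i b))"
    using opt(2) by (simp add: vec_diff c flip: sa_def sb_def)
  show "conj_dot (c i) (matrix_deriv (\<lambda>s. G s (- cnj (lam i b))) (- cnj (lam i a)) *v d i) =
        conj_dot (c i) (matrix_deriv (\<lambda>s. Gh s (- cnj (lam i b))) (- cnj (lam i a)) *v d i)"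
    using opt(3)
    by (simp add: matrix_vector_mult_diff_rdistrib conj_dot_diff c flip: sa_def sb_def)
  show "conj_dot (c i) (matrix_deriv (\<lambda>s. G (- cnj (lam i a)) s) (- cnj (lam i b)) *v d i) =
        conj_dot (c i) (matrix_deriv (\<lambda>s. Gh (- cnj (lam i a)) s) (- cnj (lam i b)) *v d i)"
    using opt(4)
    by (simp add: matrix_vector_mult_diff_rdistrib conj_dot_diff c flip: sa_def sb_def)
qed

end
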